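(* Let $T>0$, $x_0\in\mathbb R^d$, and let $\varphi:[0,T]\times\mathbb R^d\times\mathbb R\to\mathbb R$ satisfy: (i) there is $\kappa\in\mathbb R$ such that for all $t\in[0,T]$, $x\in\mathbb R^d$ and $u_1>u_2$, $\varphi(t,x,u_1)-\varphi(t,x,u_2)\le\kappa(u_1-u_2)$; (ii) there are $K>0$, $\nu>0$, $\beta\in[0,2)$ such that $|\varphi(t,x,u)|\le K\exp\big(K(|x-x_0|^\beta+|u|^\nu)\big)$ for all $t,x,u$. Let $\theta\in(0,2/\nu)$. Then there exists a constant $K'=K'(T,\theta,\kappa)>0$ such that: whenever $z_1,z_2\in\mathcal C_{\theta,x_0}([0,T]\times\mathbb R^d)$ and there exist $\mathcal L(z_1),\mathcal L(z_2)\in\mathcal C_{\theta,x_0}([0,T]\times\mathbb R^d)$ solving, for $i=1,2$ and all $(t,x)$, $$\mathcal L(z_i)(t,x)=\int_0^t\int_{\mathbb R^d}G(t-s,x-y)\,\varphi(s,y,\mathcal L(z_i)(s,y))\,dy\,ds+z_i(t,x),$$ we have $$|\mathcal L(z_1)-\mathcal L(z_2)|_{\mathcal C_{\theta,x_0}([0,T]\times\mathbb R^d)}\le K'\,|z_1-z_2|_{\mathcal C_{\theta,x_0}([0,T]\times\mathbb R^d)}.$$ The constant $K'$ does not depend on $x_0$ and depends on $\varphi$ only through $\kappa$.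
   Context: $G(t,x)=(2\pi t)^{-d/2}\exp(-|x|^2/(2t))$ is the heat kernel of $\partial_t-\frac12\Delta$ on $\mathbb R^d$. For $\theta>0$ and $x_0\in\mathbb R^d$, $\mathcal C_{\theta,x_0}([0,T]\times\mathbb R^d)$ is the set of continuous $z:[0,T]\times\mathbb R^d\to\mathbb R$ with $\lim_{|x|\to\infty}\sup_{t\in[0,T]}\frac{|z(t,x)|}{1+|x-x_0|^\theta}=0$, with norm $|z|_{\mathcal C_{\theta,x_0}}=\sup_{t\in[0,T]}\sup_{x\in\mathbb R^d}\frac{|z(t,x)|}{1+|x-x_0|^\theta}$. *)

theory Defs
  imports "HOL-Analysis.Analysis"
begin

text \<open>Heat kernel of d/dt - (1/2) Laplacian on R^d, with d = DIM('a).\<close>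
definition heat_kernel :: "real \<Rightarrow> 'a::euclidean_space \<Rightarrow> real" where
  "heat_kernel t x = (2 * pi * t) powr (- real DIM('a) / 2) * exp (- (norm x)\<^sup>2 / (2 * t))"

definition in_C_theta :: "real \<Rightarrow> real \<Rightarrow> 'a::euclidean_space \<Rightarrow> (real \<Rightarrow> 'a \<Rightarrow> real) \<Rightarrow> bool" where
  "in_C_theta T \<theta> x0 z \<longleftrightarrow>
     continuous_on ({0..T} \<times> UNIV) (\<lambda>(t, x). z t x) \<and>
     (\<forall>\<epsilon>>0. \<exists>R. \<forall>x. norm (x - x0) \<ge> R \<longrightarrow>
         (\<forall>t\<in>{0..T}. \<bar>z t x\<bar> / (1 + norm (x - x0) powr \<theta>) \<le> \<epsilon>))"

definition C_theta_norm :: "real \<Rightarrow> real \<Rightarrow> 'a::euclidean_space \<Rightarrow> (real \<Rightarrow> 'a \<Rightarrow> real) \<Rightarrow> real" where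
  "C_theta_norm T \<theta> x0 z = (SUP p \<in> {0..T} \<times> (UNIV :: 'a set).
       \<bar>z (fst p) (snd p)\<bar> / (1 + norm (snd p - x0) powr \<theta>))"

definition mild_solution :: "real \<Rightarrow> (real \<Rightarrow> 'a::euclidean_space \<Rightarrow> real \<Rightarrow> real)
     \<Rightarrow> (real \<Rightarrow> 'a \<Rightarrow> real) \<Rightarrow> (real \<Rightarrow> 'a \<Rightarrow> real) \<Rightarrow> bool" where
  "mild_solution T \<phi> z L \<longleftrightarrow>
     (\<forall>t\<in>{0..T}. \<forall>x.
        set_integrable lborel ({0..t} \<times> UNIV)
          (\<lambda>p. heat_kernel (t - fst p) (x - snd p) * \<phi> (fst p) (snd p) (L (fst p) (snd p))) \<and>
        L t x = (LINT p : {0..t} \<times> UNIV | lborel.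
          heat_kernel (t - fst p) (x - snd p) * \<phi> (fst p) (snd p) (L (fst p) (snd p))) + z t x)"

end

theory Submission
  imports Defs "HOL-Probability.Distributions"
begin

text \<open>Put \<open>\<zeta> = z1 - z2\<close> and \<open>v = (L1 - L2) - \<zeta>\<close>.  Then \<open>v\<close> is the Duhamel integral of
  \<open>H = \<phi>(\<cdot>, L1) - \<phi>(\<cdot>, L2)\<close>, and \<open>H \<le> k (v + \<zeta>)\<close> with \<open>k = max \<kappa> 0\<close> wherever \<open>v + \<zeta> > 0\<close>.
  The source \<open>H\<close> is merely measurable, so the maximum principle is applied to the mild formulation.
  Let \<open>E\<close> be the heat flow of the weight \<open>1 + |x - x0|^\<theta>\<close>; it is comparable to the weight on \<open>[0, T]\<close>.
  If \<open>exp (- l t) v - A E\<close>, with \<open>l = 2 k + 1\<close> and \<open>A\<close> so large that \<open>A E \<ge> |\<zeta>|\<close>, had a positive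
  maximum at \<open>(t, x)\<close>, restart Duhamel's formula at time \<open>t - d\<close>.  As \<open>E\<close> is a heat flow, the restarted
  part is at most \<open>exp (- l d) v(t, x)\<close>.  The source on \<open>[t - d, t]\<close> contributes at most
  \<open>d (2 k + 1/2) v(t, x)\<close>, because \<open>v + \<zeta> \<le> 2 v\<close> at \<open>(t, x)\<close> and the subquadratic exponential growth
  of \<open>H\<close> away from \<open>x\<close> is beaten by the Gaussian tail.  This is impossible for small \<open>d\<close>.
  The bound for \<open>- v\<close> follows by exchanging the two solutions.\<close>

subsection \<open>The heat kernel\<close>

text \<open>Space-time integrals run over \<open>lborel\<close> on the product type, so the
  projections are needed with respect to the Borel sets of the product; continuity gives
  this.\<close>

lemma borel_measurable_fst_borel [measurable (raw)]:
  fixes f :: "'a \<Rightarrow> 'b::second_countable_topology \<times> 'c::second_countable_topology"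
  assumes "f \<in> borel_measurable M"
  shows "(\<lambda>x. fst (f x)) \<in> borel_measurable M"
  using assms by (rule measurable_compose) (intro borel_measurable_continuous_onI continuous_intros)

lemma borel_measurable_snd_borel [measurable (raw)]:
  fixes f :: "'a \<Rightarrow> 'b::second_countable_topology \<times> 'c::second_countable_topology"
  assumes "f \<in> borel_measurable M"
  shows "(\<lambda>x. snd (f x)) \<in> borel_measurable M"
  using assms by (rule measurable_compose) (intro borel_measurable_continuous_onI continuous_intros)

lemma heat_kernel_nonneg [simp]: "0 \<le> heat_kernel t x"
  by (simp add: heat_kernel_def)

lemma heat_kernel_pos: "0 < t \<Longrightarrow> 0 < heat_kernel t x"
  by (simp add: heat_kernel_def)

lemma heat_kernel_at_0 [simp]: "heat_kernel 0 x = 0"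
  by (simp add: heat_kernel_def)

lemma heat_kernel_minus [simp]: "heat_kernel t (- x) = heat_kernel t x"
  by (simp add: heat_kernel_def)

lemma measurable_heat_kernel [measurable (raw)]:
  assumes [measurable]: "f \<in> borel_measurable M" "g \<in> borel_measurable M"
  shows "(\<lambda>w. heat_kernel (f w) (g w)) \<in> borel_measurable M"
  unfolding heat_kernel_def by measurable

text \<open>Since |x|^2 splits over the coordinates, the Gaussian factorises; the total mass in d
  dimensions then reduces to that of the one-dimensional normal density.\<close>

lemma heat_kernel_eq_prod_normal_density:
  fixes x :: "'a::euclidean_space"
  assumes "0 < t"
  shows "heat_kernel t x = (\<Prod>b\<in>Basis. normal_density 0 (sqrt t) (x \<bullet> b))"
proof -
  have exp_sum': "exp (- (\<Sum>b\<in>Basis. (x \<bullet> b)\<^sup>2 / (2 * t))) = (\<Prod>b\<in>Basis. exp (- ((x \<bullet> b)\<^sup>2 / (2 * t))))"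
    unfolding sum_negf[symmetric] by (rule exp_sum) simp
  have "(\<Prod>b\<in>(Basis::'a set). normal_density 0 (sqrt t) (x \<bullet> b))
      = (1 / sqrt (2 * pi * t)) ^ DIM('a) * exp (- (\<Sum>b\<in>Basis. (x \<bullet> b)\<^sup>2 / (2 * t)))"
    using assms unfolding exp_sum' by (simp add: normal_density_def prod_dividef power_divide)
  also have "(1 / sqrt (2 * pi * t)) ^ DIM('a) = (2 * pi * t) powr (- real DIM('a) / 2)"
  proof -
    have "1 / sqrt (2 * pi * t) = (2 * pi * t) powr (- (1 / 2))"
      using assms powr_half_sqrt[of "2 * pi * t"] by (simp add: powr_minus_divide)
    then show ?thesis
      using assms by (simp add: powr_power)
  qed
  also have "(\<Sum>b\<in>Basis. (x \<bullet> b)\<^sup>2 / (2 * t)) = (norm x)\<^sup>2 / (2 * t)"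
    unfolding power2_norm_eq_inner euclidean_inner[of x x] sum_divide_distrib by (simp add: power2_eq_square)
  finally show ?thesis
    by (simp add: heat_kernel_def)
qed

lemma nn_integral_heat_kernel:
  assumes "0 < t"
  shows "(\<integral>\<^sup>+x. ennreal (heat_kernel t (x::'a::euclidean_space)) \<partial>lborel) = 1"
proof -
  have 1: "(\<integral>\<^sup>+x. ennreal (normal_density 0 (sqrt t) x) \<partial>lborel) = 1"
    using assms by (subst nn_integral_eq_integral) auto
  have "(\<integral>\<^sup>+x. ennreal (heat_kernel t (x::'a)) \<partial>lborel)
      = (\<integral>\<^sup>+x. (\<Prod>b\<in>Basis. (\<lambda>_ y. ennreal (normal_density 0 (sqrt t) y)) b (x \<bullet> b)) \<partial>(lborel::'a measure))"
    using assms by (simp add: heat_kernel_eq_prod_normal_density prod_ennreal)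
  also have "\<dots> = 1"
    by (subst nn_integral_lborel_prod) (auto simp: 1)
  finally show ?thesis .
qed

lemma nn_integral_lborel_shift:
  fixes c :: "'a::euclidean_space"
  assumes [measurable]: "f \<in> borel_measurable borel"
  shows "(\<integral>\<^sup>+y. f (y - c) \<partial>lborel) = (\<integral>\<^sup>+y. f y \<partial>lborel)"
  by (subst lborel_distr_plus[of "- c", symmetric]) (simp add: nn_integral_distr)

lemma heat_kernel_diff_commute: "heat_kernel t (x - y) = heat_kernel t (y - x)"
  by (metis heat_kernel_minus minus_diff_eq)

lemma nn_integral_heat_kernel_shift:
  assumes "0 < t"
  shows "(\<integral>\<^sup>+y. ennreal (heat_kernel t (x - y)) \<partial>(lborel::'a::euclidean_space measure)) = 1"
  using assms nn_integral_lborel_shift[of "\<lambda>y. ennreal (heat_kernel t y)" x]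
  by (simp add: nn_integral_heat_kernel heat_kernel_diff_commute[of t x])

text \<open>Completing the square in z: up to a factor free of z, the product is a Gaussian centred
  at a weighted mean of x and y. Integrating out z then needs only the unit mass of the
  kernel.\<close>

lemma heat_kernel_mult:
  fixes x y z :: "'a::euclidean_space"
  assumes "0 < a" "0 < b"
  shows "heat_kernel a (x - z) * heat_kernel b (z - y)
    = heat_kernel (a + b) (x - y) * heat_kernel (a * b / (a + b)) ((b *\<^sub>R x + a *\<^sub>R y) /\<^sub>R (a + b) - z)"
proof -
  define u where "u = x - z"
  define w where "w = z - y"
  have xy: "x - y = u + w" by (simp add: u_def w_def)
  have m: "(b *\<^sub>R x + a *\<^sub>R y) /\<^sub>R (a + b) - z = (b *\<^sub>R u - a *\<^sub>R w) /\<^sub>R (a + b)"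
  proof -
    have "z = ((a + b) *\<^sub>R z) /\<^sub>R (a + b)" using assms by simp
    then have "(b *\<^sub>R x + a *\<^sub>R y) /\<^sub>R (a + b) - z = (b *\<^sub>R x + a *\<^sub>R y - (a + b) *\<^sub>R z) /\<^sub>R (a + b)"
      by (metis scaleR_diff_right)
    then show ?thesis by (simp add: u_def w_def algebra_simps)
  qed
  have 1: "(norm u)\<^sup>2 / (2 * a) + (norm w)\<^sup>2 / (2 * b) = (norm (u + w))\<^sup>2 / (2 * (a + b))
     + (norm ((b *\<^sub>R u - a *\<^sub>R w) /\<^sub>R (a + b)))\<^sup>2 / (2 * (a * b / (a + b)))"
  proof -
    have e: "(norm ((b *\<^sub>R u - a *\<^sub>R w) /\<^sub>R (a + b)))\<^sup>2
        = (b\<^sup>2 * (u \<bullet> u) - 2 * a * b * (u \<bullet> w) + a\<^sup>2 * (w \<bullet> w)) / (a + b)\<^sup>2"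
    proof -
      have "(norm ((b *\<^sub>R u - a *\<^sub>R w) /\<^sub>R (a + b)))\<^sup>2
          = (b *\<^sub>R u - a *\<^sub>R w) \<bullet> (b *\<^sub>R u - a *\<^sub>R w) / (a + b)\<^sup>2"
        unfolding power2_norm_eq_inner by (simp add: divide_inverse power2_eq_square)
      also have "(b *\<^sub>R u - a *\<^sub>R w) \<bullet> (b *\<^sub>R u - a *\<^sub>R w)
          = b\<^sup>2 * (u \<bullet> u) - 2 * a * b * (u \<bullet> w) + a\<^sup>2 * (w \<bullet> w)"
        by (simp add: inner_diff inner_commute[of w u] power2_eq_square algebra_simps)
      finally show ?thesis .
    qed
    have f: "(norm (u + w))\<^sup>2 = u \<bullet> u + 2 * (u \<bullet> w) + w \<bullet> w"
      unfolding power2_norm_eq_inner by (simp add: inner_add inner_commute[of w u])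
    have g: "(norm u)\<^sup>2 = u \<bullet> u" "(norm w)\<^sup>2 = w \<bullet> w"
      by (simp_all add: power2_norm_eq_inner)
    \<comment> \<open>The inner products become free reals p, q, r, so that what remains is an
      identity of rational functions.\<close>
    have h: "p / (2 * a) + q / (2 * b) = (p + 2 * r + q) / (2 * (a + b))
        + (b\<^sup>2 * p - 2 * a * b * r + a\<^sup>2 * q) / (a + b)\<^sup>2 / (2 * (a * b / (a + b)))" for p q r
    proof -
      have ne: "a \<noteq> 0" "b \<noteq> 0" "a + b \<noteq> 0" using assms by auto
      then show ?thesis by (simp add: divide_simps) algebra
    qed
    show ?thesis unfolding e f g by (rule h)
  qed
  \<comment> \<open>The normalising factors agree because a b = (a + b) (a b / (a + b)).\<close>
  have 2: "(2 * pi * a) powr q * (2 * pi * b) powr q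
     = (2 * pi * (a + b)) powr q * (2 * pi * (a * b / (a + b))) powr q" for q
  proof -
    have "(2 * pi * a) * (2 * pi * b) = (2 * pi * (a + b)) * (2 * pi * (a * b / (a + b)))"
      using assms by (simp add: field_simps)
    then show ?thesis
      by (simp only: powr_mult[symmetric])
  qed
  have 3: "exp (- (norm u)\<^sup>2 / (2 * a)) * exp (- (norm w)\<^sup>2 / (2 * b)) = exp (- (norm (u + w))\<^sup>2 / (2 * (a + b)))
     * exp (- (norm ((b *\<^sub>R u - a *\<^sub>R w) /\<^sub>R (a + b)))\<^sup>2 / (2 * (a * b / (a + b))))"
    unfolding exp_add[symmetric] minus_divide_left[symmetric] using 1 by (intro arg_cong[of _ _ exp]) linarith
  have 4: "(p * e) * (q * f) = (r * g) * (s * h)"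
    if "p * q = r * s" "e * f = g * h" for p q r s e f g h :: real
  proof -
    have "(p * e) * (q * f) = (p * q) * (e * f)" by simp
    also have "\<dots> = (r * g) * (s * h)" unfolding that by simp
    finally show ?thesis .
  qed
  have "heat_kernel a u * heat_kernel b w
    = heat_kernel (a + b) (u + w) * heat_kernel (a * b / (a + b)) ((b *\<^sub>R u - a *\<^sub>R w) /\<^sub>R (a + b))"
    unfolding heat_kernel_def by (rule 4[OF 2 3])
  then show ?thesis
    by (simp only: m xy) (simp only: u_def w_def)
qed

lemma nn_integral_heat_kernel_mult:
  fixes x y :: "'a::euclidean_space"
  assumes "0 < a" "0 < b"
  shows "(\<integral>\<^sup>+z. ennreal (heat_kernel a (x - z) * heat_kernel b (z - y)) \<partial>lborel)
    = ennreal (heat_kernel (a + b) (x - y))"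
  unfolding heat_kernel_mult[OF assms]
  using assms by (simp add: ennreal_mult nn_integral_cmult nn_integral_heat_kernel_shift)

text \<open>The kernel is cut off at nonpositive times, where \<^const>\<open>heat_kernel\<close> takes junk values;
  space-time integrals over \<open>[0, t]\<close> then become integrals over the whole space.\<close>
definition heat_kernel0 :: "real \<Rightarrow> 'a::euclidean_space \<Rightarrow> real" where
  "heat_kernel0 t x = (if 0 < t then heat_kernel t x else 0)"

lemma heat_kernel0_nonneg [simp]: "0 \<le> heat_kernel0 t x"
  by (simp add: heat_kernel0_def)

lemma measurable_heat_kernel0 [measurable (raw)]:
  assumes [measurable]: "f \<in> borel_measurable M" "g \<in> borel_measurable M"
  shows "(\<lambda>w. heat_kernel0 (f w) (g w)) \<in> borel_measurable M"
  unfolding heat_kernel0_def by measurable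

text \<open>For b <= 0 the left side vanishes although a + b may be positive; the guard on b is what
  cuts the source off at the restart time \<open>t - d\<close>.\<close>

lemma nn_integral_heat_kernel0_mult:
  fixes x y :: "'a::euclidean_space"
  assumes "0 < a"
  shows "(\<integral>\<^sup>+z. ennreal (heat_kernel a (x - z) * heat_kernel0 b (z - y)) \<partial>lborel)
    = ennreal (if 0 < b then heat_kernel0 (a + b) (x - y) else 0)"
  using assms by (auto simp: heat_kernel0_def nn_integral_heat_kernel_mult)

text \<open>Restarting Duhamel's formula at time \<open>t - d\<close>, by Chapman-Kolmogorov and Fubini.\<close>
lemma duhamel_restart:
  fixes H :: "real \<times> 'a::euclidean_space \<Rightarrow> real"
  assumes H [measurable]: "H \<in> borel_measurable borel" and d: "0 < d"
    and int: "integrable lborel (\<lambda>p. heat_kernel0 (t - fst p) (x - snd p) * H p)"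
  defines "V \<equiv> \<lambda>z. \<integral>p. heat_kernel0 (t - d - fst p) (z - snd p) * H p \<partial>lborel"
  shows "integrable lborel (\<lambda>z. heat_kernel d (x - z) * V z)"
    and "(\<integral>p. heat_kernel0 (t - fst p) (x - snd p) * H p \<partial>lborel)
      = (\<integral>z. heat_kernel d (x - z) * V z \<partial>lborel)
       + (\<integral>p. indicator {t - d..} (fst p) * (heat_kernel0 (t - fst p) (x - snd p) * H p) \<partial>lborel)"
proof -
  define F where "F = (\<lambda>p. heat_kernel0 (t - fst p) (x - snd p) * H p)"
  define Q where "Q = (\<lambda>z p. heat_kernel d (x - z) * (heat_kernel0 (t - d - fst p) (z - snd p) * H p))"
  have intF: "integrable lborel F" using int by (simp add: F_def)
  have Fm [measurable]: "F \<in> borel_measurable borel" unfolding F_def by measurable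
  have Qm [measurable]: "case_prod Q \<in> borel_measurable (lborel \<Otimes>\<^sub>M lborel)"
    unfolding Q_def case_prod_unfold by measurable
  have Qz [measurable]: "(\<lambda>z. Q z p) \<in> borel_measurable borel" for p
    unfolding Q_def by measurable
  \<comment> \<open>Integrating z first merges the two kernels into the one over the full time,
    restricted to sources before \<open>t - d\<close>. With absolute values this is the
    integrability that Fubini requires.\<close>
  have Qn: "(\<integral>\<^sup>+z. ennreal (norm (Q z p)) \<partial>lborel) = ennreal (indicator {..<t - d} (fst p) * norm (F p))" for p
  proof -
    have "(\<integral>\<^sup>+z. ennreal (norm (Q z p)) \<partial>lborel)
       = (\<integral>\<^sup>+z. ennreal (heat_kernel d (x - z) * heat_kernel0 (t - d - fst p) (z - snd p)) * ennreal \<bar>H p\<bar> \<partial>lborel)"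
      by (intro nn_integral_cong) (simp add: Q_def abs_mult mult.assoc flip: ennreal_mult)
    also have "\<dots> = ennreal (if 0 < t - d - fst p then heat_kernel0 (t - fst p) (x - snd p) else 0) * ennreal \<bar>H p\<bar>"
      using d by (subst nn_integral_multc) (simp_all add: nn_integral_heat_kernel0_mult)
    also have "\<dots> = ennreal (indicator {..<t - d} (fst p) * norm (F p))"
      by (simp add: F_def abs_mult ennreal_mult indicator_def)
    finally show ?thesis .
  qed
  have Q_eq: "(\<integral>z. Q z p \<partial>lborel) = indicator {..<t - d} (fst p) * F p" for p
  proof -
    have "has_bochner_integral lborel (\<lambda>z. heat_kernel d (x - z) * heat_kernel0 (t - d - fst p) (z - snd p))
        (if 0 < t - d - fst p then heat_kernel0 (t - fst p) (x - snd p) else 0)"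
      using d by (intro has_bochner_integral_nn_integral) (auto simp: nn_integral_heat_kernel0_mult)
    from has_bochner_integral_mult_left[OF this, of "H p"]
    have "(\<integral>z. Q z p \<partial>lborel) = (if 0 < t - d - fst p then heat_kernel0 (t - fst p) (x - snd p) else 0) * H p"
      unfolding Q_def mult.assoc[symmetric] by (intro has_bochner_integral_integral_eq) auto
    then show ?thesis by (simp add: F_def indicator_def)
  qed
  have intI: "integrable lborel (\<lambda>p. indicator A (fst p) * F p)" if [measurable]: "A \<in> sets borel" for A
    by (rule Bochner_Integration.integrable_bound[OF intF]) (auto simp: indicator_def)
  have intQ: "integrable (lborel \<Otimes>\<^sub>M lborel) (case_prod Q)"
    unfolding integrable_iff_bounded
  proof
    have "(\<integral>\<^sup>+q. ennreal (norm (case_prod Q q)) \<partial>(lborel \<Otimes>\<^sub>M lborel))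
       = (\<integral>\<^sup>+p. (\<integral>\<^sup>+z. ennreal (norm (Q z p)) \<partial>lborel) \<partial>lborel)"
      by (subst lborel_pair.nn_integral_snd[symmetric]) auto
    also have "\<dots> = (\<integral>\<^sup>+p. ennreal (norm (indicator {..<t - d} (fst p) * F p)) \<partial>lborel)"
      unfolding Qn by (intro nn_integral_cong) (simp add: abs_mult)
    also have "\<dots> < \<infinity>"
      using intI[of "{..<t - d}"] unfolding integrable_iff_bounded by auto
    finally show "(\<integral>\<^sup>+q. ennreal (norm (case_prod Q q)) \<partial>(lborel \<Otimes>\<^sub>M lborel)) < \<infinity>" .
  qed measurable
  have V: "(\<integral>p. Q z p \<partial>lborel) = heat_kernel d (x - z) * V z" for z
    by (simp add: Q_def V_def)
  show "integrable lborel (\<lambda>z. heat_kernel d (x - z) * V z)"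
    using lborel_pair.integrable_fst[OF intQ] by (simp add: V)
  have "(\<integral>z. heat_kernel d (x - z) * V z \<partial>lborel) = (\<integral>p. indicator {..<t - d} (fst p) * F p \<partial>lborel)"
    using lborel_pair.Fubini_integral[OF intQ] by (simp add: V Q_eq)
  moreover have "(\<integral>p. F p \<partial>lborel) = (\<integral>p. indicator {..<t - d} (fst p) * F p + indicator {t - d..} (fst p) * F p \<partial>lborel)"
    by (intro Bochner_Integration.integral_cong) (auto simp: indicator_def)
  ultimately show "(\<integral>p. heat_kernel0 (t - fst p) (x - snd p) * H p \<partial>lborel)
      = (\<integral>z. heat_kernel d (x - z) * V z \<partial>lborel)
       + (\<integral>p. indicator {t - d..} (fst p) * (heat_kernel0 (t - fst p) (x - snd p) * H p) \<partial>lborel)"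
    using intI[of "{..<t - d}"] intI[of "{t - d..}"] by (simp add: F_def)
qed

text \<open>Every time slice has mass one, so the integral is the length of the strip. The case
  \<open>c = 2\<close> serves the widened Gaussian of the tail estimate.\<close>

lemma has_bochner_integral_heat_kernel_strip:
  fixes x :: "'a::euclidean_space"
  assumes "0 < c" "0 \<le> d"
  shows "has_bochner_integral lborel
    (\<lambda>p. indicator {t - d..<t} (fst p) * heat_kernel (c * (t - fst p)) (x - snd p)) d"
proof (rule has_bochner_integral_nn_integral)
  have "(\<integral>\<^sup>+p. ennreal (indicator {t - d..<t} (fst p) * heat_kernel (c * (t - fst p)) (x - snd p)) \<partial>lborel)
    = (\<integral>\<^sup>+s. (\<integral>\<^sup>+y. ennreal (indicator {t - d..<t} s * heat_kernel (c * (t - s)) (x - y)) \<partial>lborel) \<partial>lborel)"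
    unfolding lborel_prod[symmetric]
    by (subst lborel.nn_integral_fst[symmetric]) (auto simp: case_prod_unfold)
  also have "\<dots> = (\<integral>\<^sup>+s. indicator {t - d..<t} s \<partial>lborel)"
    using assms by (intro nn_integral_cong) (auto simp: indicator_def nn_integral_heat_kernel_shift)
  also have "\<dots> = ennreal d"
    using assms by simp
  finally show "(\<integral>\<^sup>+p. ennreal (indicator {t - d..<t} (fst p) * heat_kernel (c * (t - fst p)) (x - snd p)) \<partial>lborel) = ennreal d" .
qed (use assms in auto)

subsection \<open>Heat flow of the weight\<close>

definition weight :: "real \<Rightarrow> 'a::euclidean_space \<Rightarrow> 'a \<Rightarrow> real" where
  "weight \<theta> x0 x = 1 + norm (x - x0) powr \<theta>"

text \<open>Written in the rescaled variable w, which makes sense at t = 0 and gives continuity up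
  to there; for t > 0 it is the convolution of the weight with the heat kernel
  (\<open>ennreal_heat_weight\<close>).\<close>

definition heat_weight :: "real \<Rightarrow> 'a::euclidean_space \<Rightarrow> real \<Rightarrow> 'a \<Rightarrow> real" where
  "heat_weight \<theta> x0 t x = (\<integral>w. heat_kernel 1 w * weight \<theta> x0 (x + sqrt t *\<^sub>R w) \<partial>lborel)"

lemma weight_ge_1: "1 \<le> weight \<theta> x0 x"
  by (simp add: weight_def)

lemma weight_pos [simp]: "0 < weight \<theta> x0 x"
  using weight_ge_1[of \<theta> x0 x] by simp

lemma weight_nonneg [simp]: "0 \<le> weight \<theta> x0 x"
  using weight_pos less_imp_le by blast

lemma measurable_weight [measurable (raw)]:
  assumes [measurable]: "f \<in> borel_measurable M"
  shows "(\<lambda>w. weight \<theta> x0 (f w)) \<in> borel_measurable M"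
  unfolding weight_def by measurable

lemma continuous_on_weight [continuous_intros]:
  assumes "0 < \<theta>" "continuous_on S f"
  shows "continuous_on S (\<lambda>w. weight \<theta> x0 (f w))"
  unfolding weight_def using assms by (intro continuous_intros continuous_on_powr') auto

text \<open>This is y <= exp y at y = c u / a, raised to the power a.\<close>

lemma powr_le_exp:
  fixes u :: real
  assumes "0 \<le> u" "0 < a" "0 < c"
  shows "u powr a \<le> (a / c) powr a * exp (c * u)"
proof -
  have "c * u / a \<le> exp (c * u / a)"
    using exp_ge_add_one_self[of "c * u / a"] by linarith
  then have "u \<le> (a / c) * exp (c * u / a)"
    using assms by (simp add: field_simps)
  then have "u powr a \<le> ((a / c) * exp (c * u / a)) powr a"
    using assms by (intro powr_mono2) auto
  also have "\<dots> = (a / c) powr a * exp (c * u)"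
    unfolding powr_mult using assms by (simp add: exp_powr_real)
  finally show ?thesis .
qed

lemma add_powr_le:
  fixes a b :: real
  assumes "0 \<le> a" "0 \<le> b" "0 < p"
  shows "(a + b) powr p \<le> 2 powr p * (a powr p + b powr p)"
proof -
  have "(a + b) powr p \<le> (2 * max a b) powr p"
    using assms by (intro powr_mono2) auto
  also have "\<dots> = 2 powr p * max a b powr p"
    using assms by (simp add: powr_mult)
  also have "\<dots> \<le> 2 powr p * (a powr p + b powr p)"
    by (intro mult_left_mono) (auto simp: max_def)
  finally show ?thesis .
qed

text \<open>The extra factor halves the Gaussian exponent, which doubles the variance; 2^(d/2) is
  the ratio of the normalising factors.\<close>

lemma heat_kernel_exp_shift:
  fixes w :: "'a::euclidean_space"
  assumes "0 < t"
  shows "heat_kernel t w * exp ((norm w)\<^sup>2 / (4 * t)) = 2 powr (DIM('a) / 2) * heat_kernel (2 * t) w"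
proof -
  have "(2 * pi * t) powr (- (real DIM('a) / 2)) = 2 powr (DIM('a) / 2) * (2 * pi * (2 * t)) powr (- (real DIM('a) / 2))"
  proof -
    have "(2 * pi * (2 * t)) powr (- (real DIM('a) / 2)) = 2 powr (- (real DIM('a) / 2)) * (2 * pi * t) powr (- (real DIM('a) / 2))"
      unfolding powr_mult[symmetric] by (simp add: mult_ac)
    moreover have "2 powr (DIM('a) / 2) * 2 powr (- (real DIM('a) / 2)) = 1"
      unfolding powr_add[symmetric] by simp
    ultimately show ?thesis by simp
  qed
  moreover have "exp (- (norm w)\<^sup>2 / (2 * t)) * exp ((norm w)\<^sup>2 / (4 * t)) = exp (- (norm w)\<^sup>2 / (2 * (2 * t)))"
    using assms unfolding exp_add[symmetric] by (simp add: field_simps)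
  ultimately show ?thesis
    unfolding heat_kernel_def by (metis (no_types, lifting) minus_divide_left mult.assoc)
qed

text \<open>The triangle inequality separates x from w, and the growth in w is absorbed by
  exp(|w|^2/4) at the price of doubling the variance. The majorant is integrable in w, and C is
  uniform in x0, x and t, which later makes K' independent of x0.\<close>

lemma weight_bound:
  assumes "0 < \<theta>" "0 \<le> T"
  obtains C where "0 < C"
    "\<And>x0 x w t. 0 \<le> t \<Longrightarrow> t \<le> T \<Longrightarrow>
      heat_kernel 1 w * weight \<theta> x0 (x + sqrt t *\<^sub>R w) \<le> C * weight \<theta> x0 x * heat_kernel 2 (w::'a::euclidean_space)"
proof -
  \<comment> \<open>C1 is the constant of \<open>powr_le_exp\<close> for u = |w|^2, exponent
    \<theta>/2 and rate 1/4; C2 collects the coefficients of the terms 1, |x - x0|^\<theta> and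
    |w|^\<theta>.\<close>
  define C1 where "C1 = (\<theta> / 2 / (1/4)) powr (\<theta> / 2)"
  define C2 where "C2 = 1 + 2 powr \<theta> + 2 powr \<theta> * sqrt T powr \<theta> * C1"
  have C1: "0 \<le> C1" by (simp add: C1_def)
  have C2: "0 < C2" unfolding C2_def using C1 by (intro add_pos_nonneg) auto
  show thesis
  proof (rule that[of "C2 * 2 powr (DIM('a) / 2)"])
    show "0 < C2 * 2 powr (DIM('a) / 2)" using C2 by simp
    fix x0 x w :: 'a and t :: real
    assume t: "0 \<le> t" "t \<le> T"
    let ?e = "exp ((norm w)\<^sup>2 / 4)"
    have nw: "norm w powr \<theta> \<le> C1 * ?e"
    proof -
      have "norm w powr \<theta> = ((norm w)\<^sup>2) powr (\<theta> / 2)"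
        by (simp add: powr_powr flip: powr_numeral)
      then show ?thesis
        using powr_le_exp[of "(norm w)\<^sup>2" "\<theta> / 2" "1/4"] assms by (simp add: C1_def)
    qed
    have "norm (x + sqrt t *\<^sub>R w - x0) \<le> norm (x - x0) + sqrt T * norm w"
    proof -
      have "norm ((x - x0) + sqrt t *\<^sub>R w) \<le> norm (x - x0) + sqrt t * norm w"
        using norm_triangle_ineq[of "x - x0" "sqrt t *\<^sub>R w"] t by simp
      also have "sqrt t * norm w \<le> sqrt T * norm w"
        using t by (intro mult_right_mono) auto
      finally show ?thesis by (simp add: algebra_simps)
    qed
    then have "norm (x + sqrt t *\<^sub>R w - x0) powr \<theta> \<le> (norm (x - x0) + sqrt T * norm w) powr \<theta>"
      using assms by (intro powr_mono2) auto
    also have "\<dots> \<le> 2 powr \<theta> * (norm (x - x0) powr \<theta> + (sqrt T * norm w) powr \<theta>)"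
      using assms by (intro add_powr_le) auto
    also have "(sqrt T * norm w) powr \<theta> = sqrt T powr \<theta> * norm w powr \<theta>"
      using assms by (simp add: powr_mult)
    finally have "weight \<theta> x0 (x + sqrt t *\<^sub>R w)
        \<le> 1 + 2 powr \<theta> * norm (x - x0) powr \<theta> + 2 powr \<theta> * sqrt T powr \<theta> * norm w powr \<theta>"
      by (simp add: weight_def algebra_simps)
    also have "\<dots> \<le> (1 + norm (x - x0) powr \<theta>) * (C2 * ?e)"
    proof -
      let ?n = "norm (x - x0) powr \<theta>"
      have e1: "1 \<le> ?e" by simp
      have "2 powr \<theta> * sqrt T powr \<theta> * norm w powr \<theta> \<le> 2 powr \<theta> * sqrt T powr \<theta> * C1 * ?e"
        using mult_left_mono[OF nw, of "2 powr \<theta> * sqrt T powr \<theta>"] by (simp add: mult.assoc)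
      also have "\<dots> \<le> (1 + ?n) * (2 powr \<theta> * sqrt T powr \<theta> * C1 * ?e)"
        using C1 by (simp add: algebra_simps)
      finally have a: "2 powr \<theta> * sqrt T powr \<theta> * norm w powr \<theta> \<le> (1 + ?n) * (2 powr \<theta> * sqrt T powr \<theta> * C1 * ?e)" .
      have "1 + 2 powr \<theta> * ?n \<le> (1 + ?n) * (1 + 2 powr \<theta>)"
        by (simp add: algebra_simps)
      also have "\<dots> \<le> (1 + ?n) * (1 + 2 powr \<theta>) * ?e"
        using mult_left_mono[OF e1, of "(1 + ?n) * (1 + 2 powr \<theta>)"] by simp
      finally have b: "1 + 2 powr \<theta> * ?n \<le> (1 + ?n) * (1 + 2 powr \<theta>) * ?e" .
      show ?thesis using a b unfolding C2_def by (simp add: algebra_simps)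
    qed
    also have "\<dots> = C2 * weight \<theta> x0 x * ?e"
      by (simp add: weight_def)
    finally have "heat_kernel 1 w * weight \<theta> x0 (x + sqrt t *\<^sub>R w) \<le> heat_kernel 1 w * (C2 * weight \<theta> x0 x * ?e)"
      by (intro mult_left_mono) auto
    also have "\<dots> = C2 * weight \<theta> x0 x * (heat_kernel 1 w * ?e)"
      by simp
    also have "heat_kernel 1 w * ?e = 2 powr (DIM('a) / 2) * heat_kernel 2 w"
      using heat_kernel_exp_shift[of 1 w] by simp
    finally show "heat_kernel 1 w * weight \<theta> x0 (x + sqrt t *\<^sub>R w)
        \<le> C2 * 2 powr (DIM('a) / 2) * weight \<theta> x0 x * heat_kernel 2 w"
      by (simp add: mult_ac)
  qed
qed

lemma has_bochner_integral_heat_kernel: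
  "0 < t \<Longrightarrow> has_bochner_integral lborel (\<lambda>y. heat_kernel t (y::'a::euclidean_space)) 1"
  by (rule has_bochner_integral_nn_integral) (auto simp: nn_integral_heat_kernel)

lemma has_bochner_integral_heat_kernel_shift:
  "0 < t \<Longrightarrow> has_bochner_integral lborel (\<lambda>y. heat_kernel t (x - y :: 'a::euclidean_space)) 1"
  by (rule has_bochner_integral_nn_integral) (auto simp: nn_integral_heat_kernel_shift)

lemma integrable_heat_weight:
  assumes "0 < \<theta>" "0 \<le> t"
  shows "integrable lborel (\<lambda>w::'a::euclidean_space. heat_kernel 1 w * weight \<theta> x0 (x + sqrt t *\<^sub>R w))"
proof -
  obtain C where C: "0 < C" "\<And>x0 x w s. 0 \<le> s \<Longrightarrow> s \<le> t \<Longrightarrow>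
      heat_kernel 1 w * weight \<theta> x0 (x + sqrt s *\<^sub>R w) \<le> C * weight \<theta> x0 x * heat_kernel 2 (w::'a)"
    using weight_bound[OF assms] by metis
  have "integrable lborel (\<lambda>w::'a. C * weight \<theta> x0 x * heat_kernel 2 w)"
    using has_bochner_integral_heat_kernel[where 'a='a, of 2] by (auto simp: has_bochner_integral_iff)
  then show ?thesis
    by (rule Bochner_Integration.integrable_bound) (use C(1) C(2)[of t _ x0 x] assms in \<open>auto intro!: AE_I2 simp: abs_mult\<close>)
qed

lemma heat_weight_le:
  assumes "0 < \<theta>" "0 \<le> T"
  obtains C where "0 < C" "\<And>x0 x t. 0 \<le> t \<Longrightarrow> t \<le> T \<Longrightarrow>
      heat_weight \<theta> x0 t (x::'a::euclidean_space) \<le> C * weight \<theta> x0 x"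
proof -
  obtain C where C: "0 < C" "\<And>x0 x w t. 0 \<le> t \<Longrightarrow> t \<le> T \<Longrightarrow>
      heat_kernel 1 w * weight \<theta> x0 (x + sqrt t *\<^sub>R w) \<le> C * weight \<theta> x0 x * heat_kernel 2 (w::'a)"
    using weight_bound[OF assms] by metis
  show thesis
  proof (rule that[OF C(1)])
    fix x0 x :: 'a and t :: real assume t: "0 \<le> t" "t \<le> T"
    have "heat_weight \<theta> x0 t x \<le> (\<integral>w. C * weight \<theta> x0 x * heat_kernel 2 (w::'a) \<partial>lborel)"
      unfolding heat_weight_def
    proof (rule integral_mono)
      show "integrable lborel (\<lambda>w::'a. C * weight \<theta> x0 x * heat_kernel 2 w)"
        using has_bochner_integral_heat_kernel[where 'a='a, of 2] by (auto simp: has_bochner_integral_iff)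
    qed (use C t assms integrable_heat_weight in auto)
    also have "\<dots> = C * weight \<theta> x0 x"
      using has_bochner_integral_heat_kernel[where 'a='a, of 2] by (auto simp: has_bochner_integral_iff)
    finally show "heat_weight \<theta> x0 t x \<le> C * weight \<theta> x0 x" .
  qed
qed

text \<open>By symmetry of the Gaussian: at least one of \<open>x \<plusminus> h\<close> is no closer to \<open>x0\<close> than \<open>x\<close>.\<close>
lemma heat_weight_ge:
  fixes x :: "'a::euclidean_space"
  assumes "0 < \<theta>" "0 \<le> t"
  shows "weight \<theta> x0 x \<le> 2 * heat_weight \<theta> x0 t x"
proof -
  let ?f = "\<lambda>w. heat_kernel 1 w * weight \<theta> x0 (x + sqrt t *\<^sub>R w)"
  let ?g = "\<lambda>w. heat_kernel 1 w * weight \<theta> x0 (x - sqrt t *\<^sub>R w)"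
  have int: "integrable lborel ?f" using assms by (rule integrable_heat_weight)
  \<comment> \<open>Reflection preserves Lebesgue measure and the kernel, so both signs of the
    displacement contribute equally.\<close>
  have distr: "(lborel :: 'a measure) = distr lborel borel uminus"
    using lborel_affine[of "-1" "0::'a"] by (simp add: density_1 fun_Compl_def)
  have g_eq: "(\<integral>w. ?g w \<partial>lborel) = (\<integral>w. ?f w \<partial>lborel)"
    by (subst (2) distr) (simp add: integral_distr)
  have "integrable (distr lborel borel uminus) ?f" using int distr by simp
  then have int': "integrable lborel ?g"
    by (subst (asm) integrable_distr_eq) auto
  have "weight \<theta> x0 x = (\<integral>w. weight \<theta> x0 x * heat_kernel 1 (w::'a) \<partial>lborel)"
    using has_bochner_integral_heat_kernel[where 'a='a, of 1] by (auto simp: has_bochner_integral_iff)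
  also have "\<dots> \<le> (\<integral>w. ?f w + ?g w \<partial>lborel)"
  proof (rule integral_mono)
    show "integrable lborel (\<lambda>w::'a. weight \<theta> x0 x * heat_kernel 1 w)"
      using has_bochner_integral_heat_kernel[where 'a='a, of 1] by (auto simp: has_bochner_integral_iff)
    fix w :: 'a
    let ?h = "sqrt t *\<^sub>R w"
    have "norm (x - x0) \<le> max (norm (x + ?h - x0)) (norm (x - ?h - x0))"
      using norm_triangle_ineq[of "x + ?h - x0" "x - ?h - x0"]
        norm_scaleR[of 2 "x - x0"] by (simp add: scaleR_2 algebra_simps max_def split: if_splits)
    then have "norm (x - x0) powr \<theta> \<le> max (norm (x + ?h - x0)) (norm (x - ?h - x0)) powr \<theta>"
      using assms by (intro powr_mono2) auto
    then have "weight \<theta> x0 x \<le> weight \<theta> x0 (x + ?h) + weight \<theta> x0 (x - ?h)"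
      unfolding weight_def max_def by (auto intro: order_trans split: if_splits)
    from mult_left_mono[OF this, of "heat_kernel 1 w"]
    show "weight \<theta> x0 x * heat_kernel 1 w \<le> ?f w + ?g w"
      by (simp add: algebra_simps)
  qed (use int int' in auto)
  also have "\<dots> = 2 * heat_weight \<theta> x0 t x"
    using int int' g_eq by (simp add: heat_weight_def)
  finally show ?thesis .
qed

text \<open>Dominated convergence along sequences: the weight stays bounded along a convergent
  sequence of points, so \<open>weight_bound\<close> supplies a single majorant, also for times
  tending to 0.\<close>

lemma continuous_on_heat_weight:
  assumes "0 < \<theta>" "0 \<le> T"
  shows "continuous_on ({0..T} \<times> UNIV) (\<lambda>(t, x::'a::euclidean_space). heat_weight \<theta> x0 t x)"
  unfolding continuous_on_sequentially
proof (intro allI ballI impI)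
  fix p :: "nat \<Rightarrow> real \<times> 'a" and a
  assume a: "a \<in> {0..T} \<times> (UNIV::'a set)" and p: "(\<forall>n. p n \<in> {0..T} \<times> UNIV) \<and> p \<longlonglongrightarrow> a"
  obtain C where C: "0 < C" "\<And>x0 x w t. 0 \<le> t \<Longrightarrow> t \<le> T \<Longrightarrow>
      heat_kernel 1 w * weight \<theta> x0 (x + sqrt t *\<^sub>R w) \<le> C * weight \<theta> x0 x * heat_kernel 2 (w::'a)"
    using weight_bound[OF assms] by metis
  have cw: "isCont (\<lambda>z. weight \<theta> x0 z) z" for z :: 'a
    using continuous_on_weight[OF assms(1) continuous_on_id, of UNIV x0]
    by (simp add: continuous_on_eq_continuous_at)
  have pf: "(\<lambda>n. fst (p n)) \<longlonglongrightarrow> fst a" and ps: "(\<lambda>n. snd (p n)) \<longlonglongrightarrow> snd a"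
    using p by (auto intro: tendsto_fst tendsto_snd)
  have "(\<lambda>n. weight \<theta> x0 (snd (p n))) \<longlonglongrightarrow> weight \<theta> x0 (snd a)"
    using isCont_tendsto_compose[OF cw ps] .
  then have "Bseq (\<lambda>n. weight \<theta> x0 (snd (p n)))"
    by (intro convergent_imp_Bseq convergentI)
  then obtain B where B: "\<And>n. weight \<theta> x0 (snd (p n)) \<le> B"
    unfolding Bseq_def by (auto dest: spec)
  have "(\<lambda>n. heat_weight \<theta> x0 (fst (p n)) (snd (p n))) \<longlonglongrightarrow> heat_weight \<theta> x0 (fst a) (snd a)"
    unfolding heat_weight_def
  proof (rule integral_dominated_convergence)
    show "integrable lborel (\<lambda>w::'a. C * B * heat_kernel 2 w)"
      using has_bochner_integral_heat_kernel[where 'a='a, of 2] by (auto simp: has_bochner_integral_iff)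
    show "AE w in lborel. (\<lambda>n. heat_kernel 1 w * weight \<theta> x0 (snd (p n) + sqrt (fst (p n)) *\<^sub>R w))
       \<longlonglongrightarrow> heat_kernel 1 w * weight \<theta> x0 (snd a + sqrt (fst a) *\<^sub>R w)"
      by (intro AE_I2 tendsto_intros isCont_tendsto_compose[OF cw] pf ps)
    fix n
    show "AE w in lborel. norm (heat_kernel 1 w * weight \<theta> x0 (snd (p n) + sqrt (fst (p n)) *\<^sub>R w))
        \<le> C * B * heat_kernel 2 w"
    proof (rule AE_I2)
      fix w :: 'a
      have "0 \<le> fst (p n)" "fst (p n) \<le> T" using p by (auto simp: mem_Times_iff)
      then have "heat_kernel 1 w * weight \<theta> x0 (snd (p n) + sqrt (fst (p n)) *\<^sub>R w)
          \<le> C * weight \<theta> x0 (snd (p n)) * heat_kernel 2 w" by (rule C)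
      also have "\<dots> \<le> C * B * heat_kernel 2 w"
        using B[of n] C(1) by (intro mult_right_mono mult_left_mono) auto
      finally show "norm (heat_kernel 1 w * weight \<theta> x0 (snd (p n) + sqrt (fst (p n)) *\<^sub>R w))
        \<le> C * B * heat_kernel 2 w" by (simp add: abs_mult)
    qed
  qed measurable
  then show "((\<lambda>(t, x). heat_weight \<theta> x0 t x) \<circ> p) \<longlonglongrightarrow> (case a of (t, x) \<Rightarrow> heat_weight \<theta> x0 t x)"
    by (simp add: o_def case_prod_unfold)
qed

text \<open>Substitute y = x + sqrt t w; the Jacobian t^(d/2) cancels the normalising factor of the
  kernel.\<close>

lemma nn_integral_heat_kernel_scale:
  fixes x :: "'a::euclidean_space"
  assumes [measurable]: "f \<in> borel_measurable borel" and "0 < t"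
  shows "(\<integral>\<^sup>+y. ennreal (heat_kernel t (x - y)) * f y \<partial>lborel)
    = (\<integral>\<^sup>+w. ennreal (heat_kernel 1 w) * f (x + sqrt t *\<^sub>R w) \<partial>lborel)"
proof -
  have k: "\<bar>sqrt t\<bar> ^ DIM('a) * heat_kernel t (sqrt t *\<^sub>R w) = heat_kernel 1 w" for w :: 'a
  proof -
    have "\<bar>sqrt t\<bar> ^ DIM('a) = t powr (real DIM('a) / 2)"
      using assms by (simp add: powr_half_sqrt[symmetric] powr_powr flip: powr_realpow)
    then show ?thesis
      using assms by (simp add: heat_kernel_def powr_mult power_mult_distrib flip: powr_add)
  qed
  have "(\<integral>\<^sup>+y. ennreal (heat_kernel t (x - y)) * f y \<partial>lborel)
      = (\<integral>\<^sup>+w. ennreal (\<bar>sqrt t\<bar> ^ DIM('a)) * (ennreal (heat_kernel t (x - (x + sqrt t *\<^sub>R w))) * f (x + sqrt t *\<^sub>R w)) \<partial>lborel)"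
    using assms(2) by (subst lborel_affine[of "sqrt t" x]) (simp_all add: nn_integral_density nn_integral_distr)
  also have "\<dots> = (\<integral>\<^sup>+w. ennreal (heat_kernel 1 w) * f (x + sqrt t *\<^sub>R w) \<partial>lborel)"
    by (intro nn_integral_cong) (simp add: mult.assoc[symmetric] k flip: ennreal_mult)
  finally show ?thesis .
qed

lemma ennreal_heat_weight:
  fixes x :: "'a::euclidean_space"
  assumes "0 < \<theta>" "0 < t"
  shows "ennreal (heat_weight \<theta> x0 t x) = (\<integral>\<^sup>+y. ennreal (heat_kernel t (x - y)) * ennreal (weight \<theta> x0 y) \<partial>lborel)"
proof -
  have "ennreal (heat_weight \<theta> x0 t x)
      = (\<integral>\<^sup>+w. ennreal (heat_kernel 1 w * weight \<theta> x0 (x + sqrt t *\<^sub>R w)) \<partial>lborel)"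
    unfolding heat_weight_def using assms
    by (intro nn_integral_eq_integral[symmetric] integrable_heat_weight) auto
  then show ?thesis
    using assms by (subst nn_integral_heat_kernel_scale) (simp_all add: ennreal_mult)
qed

lemma heat_weight_nonneg [simp]: "0 \<le> heat_weight \<theta> x0 t x"
  unfolding heat_weight_def by (intro Bochner_Integration.integral_nonneg) auto

text \<open>Tonelli and Chapman-Kolmogorov. This is what lets a multiple of
  \<open>heat_weight\<close>, used as a barrier, pass unchanged through a restart of Duhamel's
  formula.\<close>

lemma heat_weight_semigroup:
  fixes x :: "'a::euclidean_space"
  assumes "0 < \<theta>" "0 < s" "0 < d"
  shows "has_bochner_integral lborel (\<lambda>z. heat_kernel d (x - z) * heat_weight \<theta> x0 s z) (heat_weight \<theta> x0 (d + s) x)"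
proof (rule has_bochner_integral_nn_integral)
  have [measurable]: "(\<lambda>z. heat_weight \<theta> x0 s z) \<in> borel_measurable borel"
    unfolding heat_weight_def by measurable
  show "(\<lambda>z. heat_kernel d (x - z) * heat_weight \<theta> x0 s z) \<in> borel_measurable lborel"
    by measurable
  have "(\<integral>\<^sup>+z. ennreal (heat_kernel d (x - z) * heat_weight \<theta> x0 s z) \<partial>lborel)
      = (\<integral>\<^sup>+z. (\<integral>\<^sup>+y. ennreal (heat_kernel d (x - z)) * (ennreal (heat_kernel s (z - y)) * ennreal (weight \<theta> x0 y)) \<partial>lborel) \<partial>lborel)"
    using assms by (intro nn_integral_cong) (simp add: ennreal_mult ennreal_heat_weight nn_integral_cmult)
  also have "\<dots> = (\<integral>\<^sup>+y. (\<integral>\<^sup>+z. ennreal (heat_kernel d (x - z)) * (ennreal (heat_kernel s (z - y)) * ennreal (weight \<theta> x0 y)) \<partial>lborel) \<partial>lborel)"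
    by (rule lborel_pair.Fubini') (simp add: case_prod_unfold, measurable)
  also have "\<dots> = (\<integral>\<^sup>+y. (\<integral>\<^sup>+z. ennreal (heat_kernel d (x - z) * heat_kernel s (z - y)) \<partial>lborel) * ennreal (weight \<theta> x0 y) \<partial>lborel)"
    by (simp add: ennreal_mult mult.assoc nn_integral_multc flip: nn_integral_multc)
  also have "\<dots> = ennreal (heat_weight \<theta> x0 (d + s) x)"
    using assms by (simp add: nn_integral_heat_kernel_mult ennreal_heat_weight)
  finally show "(\<integral>\<^sup>+z. ennreal (heat_kernel d (x - z) * heat_weight \<theta> x0 s z) \<partial>lborel) = ennreal (heat_weight \<theta> x0 (d + s) x)" .
qed auto

text \<open>One half of the exponent |z|^2/(2r) remains as the kernel at time 2r. The other half
  splits again: one |z|^2/(8r) pays for |z|^2/8 as r <= 1, and the other is at least a, leaving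
  exp(-a) <= 1/a, a bound of order r.\<close>

lemma heat_kernel_far_le:
  fixes z :: "'a::euclidean_space"
  assumes "0 < r" "r \<le> 1" "0 < e" "e \<le> norm z"
  shows "heat_kernel r z * exp ((norm z)\<^sup>2 / 8) \<le> 2 powr (DIM('a) / 2) * (8 * r / e\<^sup>2) * heat_kernel (2 * r) z"
proof -
  define a where "a = e\<^sup>2 / (8 * r)"
  have a: "0 < a" using assms by (simp add: a_def)
  have sq: "e\<^sup>2 \<le> (norm z)\<^sup>2" using assms by (intro power_mono) auto
  have "(norm z)\<^sup>2 / 8 \<le> (norm z)\<^sup>2 / (8 * r)"
    using assms by (intro divide_left_mono) auto
  moreover have "a \<le> (norm z)\<^sup>2 / (8 * r)"
    unfolding a_def using sq assms by (intro divide_right_mono) auto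
  moreover have "(norm z)\<^sup>2 / (4 * r) = (norm z)\<^sup>2 / (8 * r) + (norm z)\<^sup>2 / (8 * r)"
    by simp
  ultimately have "(norm z)\<^sup>2 / 8 \<le> (norm z)\<^sup>2 / (4 * r) + - a"
    by linarith
  then have "exp ((norm z)\<^sup>2 / 8) \<le> exp ((norm z)\<^sup>2 / (4 * r)) * exp (- a)"
    by (simp flip: exp_add)
  also have "exp (- a) \<le> 1 / a"
  proof -
    have "a \<le> exp a" using exp_ge_add_one_self[of a] by linarith
    then show ?thesis using a by (simp add: exp_minus field_simps)
  qed
  finally have "exp ((norm z)\<^sup>2 / 8) \<le> exp ((norm z)\<^sup>2 / (4 * r)) * (1 / a)"
    by (simp add: mult_left_mono)
  then have "heat_kernel r z * exp ((norm z)\<^sup>2 / 8) \<le> heat_kernel r z * (exp ((norm z)\<^sup>2 / (4 * r)) * (1 / a))"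
    by (intro mult_left_mono) auto
  also have "\<dots> = 2 powr (DIM('a) / 2) * heat_kernel (2 * r) z * (1 / a)"
    using heat_kernel_exp_shift[of r z] assms by simp
  finally show ?thesis by (simp add: a_def mult_ac)
qed

subsection \<open>A maximum principle for mild formulations\<close>

text \<open>The contradiction is a first-order comparison in the step d: passing from ts - d to ts,
  the factor exp(-l d) loses about l d, while the source returns at most (l - 1/2) d.\<close>

lemma mild_comparison:
  fixes v \<zeta> :: "real \<Rightarrow> 'a::euclidean_space \<Rightarrow> real" and H :: "real \<times> 'a \<Rightarrow> real"
  assumes \<theta>: "0 < \<theta>" and T: "0 < T" and k: "0 \<le> k"
    and Hm [measurable]: "H \<in> borel_measurable borel"
    and H0: "\<And>s y. s < 0 \<Longrightarrow> H (s, y) = 0"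
    and growth: "\<And>c. 0 < c \<Longrightarrow> \<exists>C. \<forall>p. \<bar>H p\<bar> \<le> C * exp (c * (norm (snd p - x0))\<^sup>2)"
    and int: "\<And>t x. t \<in> {0..T} \<Longrightarrow> integrable lborel (\<lambda>p. heat_kernel0 (t - fst p) (x - snd p) * H p)"
    and v_eq: "\<And>t x. t \<in> {0..T} \<Longrightarrow> v t x = (\<integral>p. heat_kernel0 (t - fst p) (x - snd p) * H p \<partial>lborel)"
    and diss: "\<And>s y. s \<in> {0..T} \<Longrightarrow> 0 < v s y + \<zeta> s y \<Longrightarrow> H (s, y) \<le> k * (v s y + \<zeta> s y)"
    and v_in: "in_C_theta T \<theta> x0 v"
    and \<zeta>_cont: "continuous_on ({0..T} \<times> UNIV) (\<lambda>(t, x). \<zeta> t x)"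
    and \<zeta>_le: "\<And>t x. t \<in> {0..T} \<Longrightarrow> \<bar>\<zeta> t x\<bar> \<le> M * weight \<theta> x0 x"
    and A: "0 < A" "2 * M \<le> A"
    and t: "t \<in> {0..T}"
  shows "v t x \<le> exp ((2 * k + 1) * t) * (A * heat_weight \<theta> x0 t x)"
proof (rule ccontr)
  assume contra: "\<not> ?thesis"
  \<comment> \<open>The source rate will be 2k + 1/2: 2k from the bound 2V on v + \<zeta> at the
    maximum, 1/4 from the oscillation nearby and 1/4 from the Gaussian tail. The choice of l exceeds
    it by 1/2.\<close>
  define l where "l = 2 * k + 1"
  have l: "1 \<le> l" using k by (simp add: l_def)
  define E where "E = (\<lambda>s y. A * heat_weight \<theta> x0 s y)"
  define \<Phi> where "\<Phi> = (\<lambda>(s, y). exp (- (l * s)) * v s y - E s y)"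
  have E_ge: "A / 2 * weight \<theta> x0 y \<le> E s y" if "0 \<le> s" for s y
    using mult_left_mono[OF heat_weight_ge[OF \<theta> that, of x0 y], of "A / 2"] A by (simp add: E_def)
  have v_\<Phi>: "v s y = exp (l * s) * (E s y + \<Phi> (s, y))" for s y
    by (simp add: \<Phi>_def flip: exp_add mult.assoc)
  have v_cont: "continuous_on ({0..T} \<times> UNIV) (\<lambda>(t, x). v t x)"
    using v_in by (simp add: in_C_theta_def)
  have \<Phi>_cont: "continuous_on ({0..T} \<times> UNIV) \<Phi>"
    using v_cont continuous_on_heat_weight[OF \<theta>, of T x0] T
    unfolding \<Phi>_def E_def case_prod_unfold by (intro continuous_intros) auto
  have pos: "0 < \<Phi> (t, x)"
  proof -
    have "exp (l * t) * E t x < exp (l * t) * (E t x + \<Phi> (t, x))"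
      using contra v_\<Phi>[of t x] by (simp add: l_def E_def)
    then show ?thesis by simp
  qed
  \<comment> \<open>Decay of v relative to the weight, together with \<open>E_ge\<close>, makes
    \<Phi> nonpositive outside a ball, so a maximum over a compact set is a global one.\<close>
  obtain R where R: "\<And>y s. R \<le> norm (y - x0) \<Longrightarrow> s \<in> {0..T} \<Longrightarrow> \<bar>v s y\<bar> / (1 + norm (y - x0) powr \<theta>) \<le> A / 2"
    using v_in A unfolding in_C_theta_def by (meson half_gt_zero)
  have out: "\<Phi> (s, y) \<le> 0" if "R \<le> norm (y - x0)" "s \<in> {0..T}" for s y
  proof -
    have "\<bar>v s y\<bar> / weight \<theta> x0 y \<le> A / 2"
      using R[OF that] by (simp add: weight_def)
    then have "\<bar>v s y\<bar> \<le> A / 2 * weight \<theta> x0 y"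
      by (subst (asm) pos_divide_le_eq) auto
    also have "\<dots> \<le> E s y" using that by (intro E_ge) auto
    finally have "\<bar>v s y\<bar> \<le> E s y" .
    moreover have "exp (- (l * s)) * v s y \<le> 1 * \<bar>v s y\<bar>"
      using that l by (intro order_trans[OF mult_left_mono mult_right_mono]) auto
    ultimately show ?thesis by (simp add: \<Phi>_def)
  qed

  \<comment> \<open>Attaining a positive maximum\<close>
  have "compact ({0..T} \<times> cball x0 R)"
    by (intro compact_Times) auto
  moreover have "(t, x) \<in> {0..T} \<times> cball x0 R"
    using t pos out[of x t] by (force simp: dist_norm norm_minus_commute)
  moreover have "continuous_on ({0..T} \<times> cball x0 R) \<Phi>"
    by (rule continuous_on_subset[OF \<Phi>_cont]) auto
  ultimately obtain p where p: "p \<in> {0..T} \<times> cball x0 R" "\<And>q. q \<in> {0..T} \<times> cball x0 R \<Longrightarrow> \<Phi> q \<le> \<Phi> p"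
    using continuous_attains_sup[of "{0..T} \<times> cball x0 R" \<Phi>] by blast
  define ts where "ts = fst p"
  define xs where "xs = snd p"
  define m where "m = \<Phi> (ts, xs)"
  define V where "V = v ts xs"
  have m: "0 < m"
    using pos p(2)[of "(t, x)"] \<open>(t, x) \<in> {0..T} \<times> cball x0 R\<close> by (simp add: m_def ts_def xs_def)
  have max: "\<Phi> (s, y) \<le> m" if "s \<in> {0..T}" for s y
  proof (cases "R \<le> norm (y - x0)")
    case True
    then show ?thesis using out[OF _ that] m by force
  next
    case False
    then show ?thesis using p(2)[of "(s, y)"] that by (simp add: m_def ts_def xs_def dist_norm norm_minus_commute)
  qed
  have ts_in: "ts \<in> {0..T}" using p(1) by (auto simp: ts_def)
  \<comment> \<open>At time 0 the cut-off kernel sees only sources at s < 0, where H vanishes; hence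
    v = 0 there and \<Phi> = -E <= 0.\<close>
  have "ts \<noteq> 0"
  proof
    assume "ts = 0"
    have z: "heat_kernel0 (0 - fst q) (xs - snd q) * H q = 0" for q
      using H0[of "fst q" "snd q"] by (simp add: heat_kernel0_def)
    have "v ts xs = 0"
      using v_eq[OF ts_in, of xs] unfolding \<open>ts = 0\<close> z by simp
    then have "m = - E ts xs" by (simp add: m_def \<Phi>_def)
    moreover have "0 \<le> E ts xs" using A by (simp add: E_def)
    ultimately show False using m by linarith
  qed
  then have ts: "0 < ts" "ts \<le> T" using ts_in by auto
  have V_eq: "V = exp (l * ts) * (E ts xs + m)"
    unfolding V_def m_def by (rule v_\<Phi>)
  \<comment> \<open>As |\<zeta>| <= M weight < V at the maximum, v + \<zeta> lies strictly between 0
    and 2V, so the one-sided bound on H applies there.\<close>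
  have V_gt: "M * weight \<theta> x0 xs < V"
  proof -
    have "M * weight \<theta> x0 xs \<le> A / 2 * weight \<theta> x0 xs"
      using A by (intro mult_right_mono) auto
    also have "\<dots> \<le> E ts xs" using ts by (intro E_ge) auto
    also have "\<dots> < 1 * (E ts xs + m)" using m by simp
    also have "\<dots> \<le> V"
      unfolding V_eq using l ts m A by (intro mult_right_mono) (auto simp: E_def)
    finally show ?thesis .
  qed
  have V_pos: "0 < V"
    unfolding V_eq using m A by (intro mult_pos_pos add_nonneg_pos) (auto simp: E_def)

  \<comment> \<open>The source near and far from the maximum\<close>
  define W where "W = (\<lambda>(s, y). v s y + \<zeta> s y)"
  have W_cont: "continuous_on ({0..T} \<times> UNIV) W"
    using v_cont \<zeta>_cont unfolding W_def case_prod_unfold by (intro continuous_intros)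
  have W_pos: "0 < W (ts, xs)" and W_le: "W (ts, xs) \<le> 2 * V"
    using \<zeta>_le[OF ts_in, of xs] V_gt by (auto simp: W_def V_def)
  \<comment> \<open>The first tolerance keeps W positive, so that \<open>diss\<close> applies
    nearby; the second costs at most k V / (4 (k + 1)) <= V/4.\<close>
  obtain e0 where e0: "0 < e0" "\<And>q. q \<in> {0..T} \<times> UNIV \<Longrightarrow> dist q (ts, xs) < e0 \<Longrightarrow>
      dist (W q) (W (ts, xs)) < min (W (ts, xs)) (V / (4 * (k + 1)))"
    using W_cont[unfolded continuous_on_iff, rule_format, of "(ts, xs)" "min (W (ts, xs)) (V / (4 * (k + 1)))"]
      ts_in W_pos V_pos k by auto
  \<comment> \<open>Halved because the distance in space-time is estimated by the sum of the
    distances in time and in space.\<close>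
  define e where "e = e0 / 2"
  have e: "0 < e" using e0 by (simp add: e_def)
  have near: "H (s, y) \<le> (2 * k + 1/4) * V" if "ts - e < s" "0 \<le> s" "s \<le> ts" "norm (xs - y) < e" for s y
  proof -
    have "dist (s, y) (ts, xs) \<le> dist s ts + dist y xs"
      unfolding dist_Pair_Pair by (rule sqrt_sum_squares_le_sum) auto
    also have "\<dots> < e0"
      using that by (auto simp: dist_norm e_def norm_minus_commute)
    finally have d: "dist (W (s, y)) (W (ts, xs)) < min (W (ts, xs)) (V / (4 * (k + 1)))"
      using that ts by (intro e0) auto
    have "0 < W (s, y)" using d by (auto simp: dist_real_def)
    then have "H (s, y) \<le> k * W (s, y)"
      using diss[of s y] that ts by (simp add: W_def)
    also have "\<dots> \<le> k * (2 * V + V / (4 * (k + 1)))"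
      using d W_le k by (intro mult_left_mono) (auto simp: dist_real_def)
    also have "k * (V / (4 * (k + 1))) \<le> V / 4"
      using k V_pos by (simp add: field_simps)
    then have "k * (2 * V + V / (4 * (k + 1))) \<le> (2 * k + 1/4) * V"
      by (simp add: algebra_simps)
    finally show ?thesis .
  qed
  \<comment> \<open>Moving the centre from x0 to xs doubles the rate 1/16 to 1/8, the rate that
    \<open>heat_kernel_far_le\<close> can absorb.\<close>
  obtain C where C: "\<And>p. \<bar>H p\<bar> \<le> C * exp (1/16 * (norm (snd p - x0))\<^sup>2)"
    using growth[of "1/16"] by (meson zero_less_divide_1_iff zero_less_numeral)
  have C0: "0 \<le> C"
    using order_trans[OF abs_ge_zero C[of "(0, x0)"]] by simp
  define D where "D = C * exp ((norm (xs - x0))\<^sup>2 / 8)"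
  have D0: "0 \<le> D" using C0 by (simp add: D_def)
  have HD: "\<bar>H (s, y)\<bar> \<le> D * exp ((norm (xs - y))\<^sup>2 / 8)" for s y
  proof -
    have "norm (y - x0) \<le> norm (xs - y) + norm (xs - x0)"
      using norm_triangle_ineq4[of "xs - x0" "xs - y"] by (simp add: algebra_simps)
    then have "(norm (y - x0))\<^sup>2 \<le> (norm (xs - y) + norm (xs - x0))\<^sup>2"
      by (intro power_mono) auto
    also have "\<dots> \<le> 2 * (norm (xs - y))\<^sup>2 + 2 * (norm (xs - x0))\<^sup>2"
      using sum_squares_bound[of "norm (xs - y)" "norm (xs - x0)"] by (simp add: power2_sum)
    finally have "1/16 * (norm (y - x0))\<^sup>2 \<le> (norm (xs - x0))\<^sup>2 / 8 + (norm (xs - y))\<^sup>2 / 8"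
      by simp
    then have "C * exp (1/16 * (norm (y - x0))\<^sup>2) \<le> C * exp ((norm (xs - x0))\<^sup>2 / 8 + (norm (xs - y))\<^sup>2 / 8)"
      using C0 by (intro mult_left_mono) auto
    then show ?thesis
      using C[of "(s, y)"] by (simp add: D_def exp_add)
  qed

  \<comment> \<open>Choice of the time step\<close>
  define D' where "D' = D * 2 powr (DIM('a) / 2)"
  have D'0: "0 \<le> D'" using D0 by (simp add: D'_def)
  have "0 < V * e\<^sup>2 / (32 * (D' + 1))" "0 < 1 / (4 * l\<^sup>2)"
    using V_pos e D'0 l by auto
  then have "0 < min (min ts e) (min (min 1 (1 / (4 * l\<^sup>2))) (V * e\<^sup>2 / (32 * (D' + 1))))"
    using ts e by (simp only: min_less_iff_conj) simp
  \<comment> \<open>\<open>d < ts\<close> keeps the restart time positive, as the semigroup law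
    requires; \<open>d < e\<close> keeps the strip close to ts; d <= 1 admits the tail estimate; the
    last bound makes the tail at most V/4, and \<open>1 / (4 l^2)\<close> closes the final
    inequality. Adding 1 to D' avoids a zero denominator.\<close>
  then obtain d where "0 < d" "d < min (min ts e) (min (min 1 (1 / (4 * l\<^sup>2))) (V * e\<^sup>2 / (32 * (D' + 1))))"
    using dense by blast
  then have d: "0 < d" "d < ts" "d < e" "d \<le> 1" "d \<le> 1 / (4 * l\<^sup>2)" "d \<le> V * e\<^sup>2 / (32 * (D' + 1))"
    by (simp_all only: min_less_iff_conj less_imp_le)
  have d_far: "D' * (8 * r / e\<^sup>2) \<le> V / 4" if "0 < r" "r \<le> d" for r
  proof -
    have "r * (32 * (D' + 1)) \<le> V * e\<^sup>2"
      using that d(6) D'0 by (subst (asm) pos_le_divide_eq) (auto intro: order_trans[OF mult_right_mono])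
    moreover have "32 * (D' * r) \<le> r * (32 * (D' + 1))" using that by (simp add: algebra_simps)
    ultimately have "32 * (D' * r) \<le> V * e\<^sup>2" by linarith
    then show ?thesis using e by (simp add: field_simps)
  qed
  \<comment> \<open>Majorants of mass d: \<open>S 1\<close> carries the source within distance e of
    xs, \<open>S 2\<close> the tail with doubled variance.\<close>
  define S where "S = (\<lambda>(c::real) q. indicator {ts - d..<ts} (fst q) * heat_kernel (c * (ts - fst q)) (xs - snd q))"
  have S_int: "has_bochner_integral lborel (S c) d" if "0 < c" for c
    unfolding S_def using that d by (intro has_bochner_integral_heat_kernel_strip) auto
  have S_nonneg: "0 \<le> S c q" for c q by (simp add: S_def)
  have pointwise: "indicator {ts - d..} (fst q) * (heat_kernel0 (ts - fst q) (xs - snd q) * H q)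
      \<le> (2 * k + 1/4) * V * S 1 q + V / 4 * S 2 q" for q
  proof (cases "fst q \<in> {ts - d..<ts}")
    case False
    then have "indicator {ts - d..} (fst q) * (heat_kernel0 (ts - fst q) (xs - snd q) * H q) = 0"
      by (auto simp: heat_kernel0_def indicator_def)
    then show ?thesis
      using S_nonneg k V_pos by (simp only:) (intro add_nonneg_nonneg mult_nonneg_nonneg, auto)
  next
    case True
    define r where "r = ts - fst q"
    define z where "z = xs - snd q"
    have r: "0 < r" "r \<le> d" using True by (auto simp: r_def)
    have S: "S 1 q = heat_kernel r z" "S 2 q = heat_kernel (2 * r) z"
      using True by (simp_all add: S_def r_def z_def)
    have eq: "indicator {ts - d..} (fst q) * (heat_kernel0 (ts - fst q) (xs - snd q) * H q) = heat_kernel r z * H q"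
      using True r by (simp add: heat_kernel0_def r_def z_def)
    show ?thesis
    proof (cases "norm z < e")
      case True
      then have "H q \<le> (2 * k + 1/4) * V"
        using near[of "fst q" "snd q"] r d by (simp add: r_def z_def)
      then have "heat_kernel r z * H q \<le> heat_kernel r z * ((2 * k + 1/4) * V)"
        by (intro mult_left_mono) auto
      then show ?thesis
        unfolding eq using S V_pos by (simp add: mult.commute add_increasing2)
    next
      case False
      have "heat_kernel r z * H q \<le> heat_kernel r z * (D * exp ((norm z)\<^sup>2 / 8))"
        using HD[of "fst q" "snd q"] by (intro mult_left_mono) (auto simp: z_def)
      also have "\<dots> = D * (heat_kernel r z * exp ((norm z)\<^sup>2 / 8))" by simp
      also have "\<dots> \<le> D * (2 powr (DIM('a) / 2) * (8 * r / e\<^sup>2) * heat_kernel (2 * r) z)"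
        using False r d e D0 by (intro mult_left_mono heat_kernel_far_le) auto
      also have "\<dots> = D' * (8 * r / e\<^sup>2) * heat_kernel (2 * r) z"
        by (simp add: D'_def)
      also have "\<dots> \<le> V / 4 * heat_kernel (2 * r) z"
        using d_far[OF r] by (intro mult_right_mono) auto
      finally show ?thesis
        unfolding eq using S V_pos k by (simp add: add_increasing)
    qed
  qed

  \<comment> \<open>Restart before the maximum and contradiction\<close>
  note restart = duhamel_restart[OF Hm d(1) int[OF ts_in, of xs]]
  have td: "ts - d \<in> {0..T}" using d ts by auto
  have V_restart: "V = (\<integral>z. heat_kernel d (xs - z) * v (ts - d) z \<partial>lborel)
      + (\<integral>q. indicator {ts - d..} (fst q) * (heat_kernel0 (ts - fst q) (xs - snd q) * H q) \<partial>lborel)"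
    using restart(2) by (simp add: V_def v_eq[OF ts_in] v_eq[OF td])
  \<comment> \<open>By maximality v at time ts - d is at most exp (l (ts - d)) (E + m) everywhere.
    The heat flow reproduces E and the constant m, so the bound at (ts, xs) becomes exp (- l d)
    V.\<close>
  have hk: "has_bochner_integral lborel (\<lambda>z. exp (l * (ts - d)) * (A * (heat_kernel d (xs - z) * heat_weight \<theta> x0 (ts - d) z) + m * heat_kernel d (xs - z)))
      (exp (l * (ts - d)) * (A * heat_weight \<theta> x0 (d + (ts - d)) xs + m * 1))"
    using d \<theta> by (intro has_bochner_integral_mult_right has_bochner_integral_add heat_weight_semigroup has_bochner_integral_heat_kernel_shift) auto
  have "(\<integral>z. heat_kernel d (xs - z) * v (ts - d) z \<partial>lborel)
      \<le> (\<integral>z. exp (l * (ts - d)) * (A * (heat_kernel d (xs - z) * heat_weight \<theta> x0 (ts - d) z) + m * heat_kernel d (xs - z)) \<partial>lborel)"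
  proof (rule integral_mono)
    show "integrable lborel (\<lambda>z. heat_kernel d (xs - z) * v (ts - d) z)"
      using restart(1) by (simp add: v_eq[OF td])
    show "integrable lborel (\<lambda>z. exp (l * (ts - d)) * (A * (heat_kernel d (xs - z) * heat_weight \<theta> x0 (ts - d) z) + m * heat_kernel d (xs - z)))"
      using hk by (rule integrable.intros)
    fix z
    have "v (ts - d) z \<le> exp (l * (ts - d)) * (E (ts - d) z + m)"
      unfolding v_\<Phi>[of "ts - d" z] using max[OF td, of z] by (intro mult_left_mono) auto
    then have "heat_kernel d (xs - z) * v (ts - d) z \<le> heat_kernel d (xs - z) * (exp (l * (ts - d)) * (E (ts - d) z + m))"
      by (intro mult_left_mono) auto
    then show "heat_kernel d (xs - z) * v (ts - d) z
        \<le> exp (l * (ts - d)) * (A * (heat_kernel d (xs - z) * heat_weight \<theta> x0 (ts - d) z) + m * heat_kernel d (xs - z))"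
      by (simp add: E_def algebra_simps)
  qed
  also have "\<dots> = exp (l * (ts - d)) * (E ts xs + m)"
    using has_bochner_integral_integral_eq[OF hk] by (simp add: E_def)
  also have "\<dots> = exp (- (l * d)) * V"
    by (simp add: V_eq right_diff_distrib exp_diff exp_minus field_simps)
  finally have part1: "(\<integral>z. heat_kernel d (xs - z) * v (ts - d) z \<partial>lborel) \<le> exp (- (l * d)) * V" .
  have S12: "has_bochner_integral lborel (\<lambda>q. (2 * k + 1/4) * V * S 1 q + V / 4 * S 2 q) ((2 * k + 1/4) * V * d + V / 4 * d)"
    by (intro has_bochner_integral_mult_right has_bochner_integral_add S_int) auto
  have "(\<integral>q. indicator {ts - d..} (fst q) * (heat_kernel0 (ts - fst q) (xs - snd q) * H q) \<partial>lborel)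
     \<le> (\<integral>q. (2 * k + 1/4) * V * S 1 q + V / 4 * S 2 q \<partial>lborel)"
  proof (rule integral_mono)
    show "integrable lborel (\<lambda>q. indicator {ts - d..} (fst q) * (heat_kernel0 (ts - fst q) (xs - snd q) * H q))"
      by (rule Bochner_Integration.integrable_bound[OF int[OF ts_in, of xs]]) (auto simp: indicator_def)
    show "integrable lborel (\<lambda>q. (2 * k + 1/4) * V * S 1 q + V / 4 * S 2 q)"
      using S12 by (rule integrable.intros)
  qed (rule pointwise)
  also have "\<dots> = (2 * k + 1/4) * V * d + V / 4 * d"
    using S12 by (rule has_bochner_integral_integral_eq)
  also have "\<dots> = (l - 1/2) * d * V"
    by (simp add: l_def algebra_simps)
  finally have "V \<le> (exp (- (l * d)) + (l - 1/2) * d) * V"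
    using V_restart part1 by (simp add: algebra_simps)
  then have le: "1 \<le> exp (- (l * d)) + (l - 1/2) * d"
    using V_pos by simp
  \<comment> \<open>Multiplying 1 <= exp(-u) + (l - 1/2) d by 1 + u <= exp u gives 1/2 <= (l - 1/2)
    u, whereas l u = l^2 d <= 1/4.\<close>
  define u where "u = l * d"
  have u: "0 < u" using l d by (simp add: u_def)
  have "(1 + u) * exp (- u) \<le> 1"
    using exp_ge_add_one_self[of u] by (simp add: exp_minus field_simps)
  moreover have "(1 + u) * 1 \<le> (1 + u) * (exp (- u) + (l - 1/2) * d)"
    using le u by (intro mult_left_mono) (auto simp: u_def)
  ultimately have "u \<le> (1 + u) * ((l - 1/2) * d)"
    by (simp add: algebra_simps)
  then have "d * (1/2) \<le> d * ((l - 1/2) * u)"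
    by (simp add: u_def algebra_simps)
  then have "1/2 \<le> (l - 1/2) * u" using d by simp
  also have "\<dots> \<le> l * u" using u by (intro mult_right_mono) auto
  also have "\<dots> \<le> 1/4"
    using d(5) l by (simp add: u_def power2_eq_square field_simps)
  finally show False by simp
qed

subsection \<open>The weighted spaces and the growth of the nonlinearity\<close>

lemma in_C_theta_diff:
  assumes "in_C_theta T \<theta> x0 f" "in_C_theta T \<theta> x0 g"
  shows "in_C_theta T \<theta> x0 (\<lambda>t x. f t x - g t x)"
  unfolding in_C_theta_def
proof (intro conjI allI impI)
  show "continuous_on ({0..T} \<times> UNIV) (\<lambda>(t, x). f t x - g t x)"
    using assms unfolding in_C_theta_def case_prod_unfold by (intro continuous_intros) auto
  fix \<epsilon> :: real assume "0 < \<epsilon>"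
  then have "0 < \<epsilon> / 2" by simp
  with assms obtain R1 R2 where
    R1: "\<And>x t. R1 \<le> norm (x - x0) \<Longrightarrow> t \<in> {0..T} \<Longrightarrow> \<bar>f t x\<bar> / (1 + norm (x - x0) powr \<theta>) \<le> \<epsilon> / 2" and
    R2: "\<And>x t. R2 \<le> norm (x - x0) \<Longrightarrow> t \<in> {0..T} \<Longrightarrow> \<bar>g t x\<bar> / (1 + norm (x - x0) powr \<theta>) \<le> \<epsilon> / 2"
    unfolding in_C_theta_def by meson
  have "\<bar>f t x - g t x\<bar> / (1 + norm (x - x0) powr \<theta>) \<le> \<epsilon>"
    if "max R1 R2 \<le> norm (x - x0)" "t \<in> {0..T}" for x t
  proof -
    have "\<bar>f t x - g t x\<bar> / (1 + norm (x - x0) powr \<theta>) \<le> (\<bar>f t x\<bar> + \<bar>g t x\<bar>) / (1 + norm (x - x0) powr \<theta>)"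
      by (intro divide_right_mono) auto
    then show ?thesis
      using R1[of x t] R2[of x t] that by (simp add: add_divide_distrib)
  qed
  then show "\<exists>R. \<forall>x. R \<le> norm (x - x0) \<longrightarrow> (\<forall>t\<in>{0..T}. \<bar>f t x - g t x\<bar> / (1 + norm (x - x0) powr \<theta>) \<le> \<epsilon>)"
    by blast
qed

text \<open>Compactness inside a ball and decay outside. Boundedness is what makes the real
  \<open>SUP\<close> in the norm an actual upper bound.\<close>

lemma in_C_theta_bdd_above:
  assumes "in_C_theta T \<theta> x0 z" "0 < \<theta>"
  shows "bdd_above ((\<lambda>p. \<bar>z (fst p) (snd p)\<bar> / (1 + norm (snd p - x0) powr \<theta>)) ` ({0..T} \<times> UNIV))"
proof -
  let ?f = "\<lambda>p. \<bar>z (fst p) (snd p)\<bar> / (1 + norm (snd p - x0) powr \<theta>)"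
  obtain R where R: "\<And>x t. R \<le> norm (x - x0) \<Longrightarrow> t \<in> {0..T} \<Longrightarrow> \<bar>z t x\<bar> / (1 + norm (x - x0) powr \<theta>) \<le> 1"
    using assms unfolding in_C_theta_def by (meson zero_less_one)
  have "continuous_on ({0..T} \<times> UNIV) (\<lambda>p. \<bar>z (fst p) (snd p)\<bar> / weight \<theta> x0 (snd p))"
  proof (intro continuous_on_divide continuous_on_rabs continuous_on_weight assms(2) ballI)
    show "continuous_on ({0..T} \<times> UNIV) (\<lambda>p. z (fst p) (snd p))"
      using assms by (simp add: in_C_theta_def case_prod_unfold)
    show "weight \<theta> x0 (snd p) \<noteq> 0" for p :: "real \<times> 'a"
      using weight_pos[of \<theta> x0 "snd p"] by linarith
  qed (intro continuous_intros)
  then have "continuous_on ({0..T} \<times> UNIV) ?f"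
    by (simp add: weight_def)
  then have "compact (?f ` ({0..T} \<times> cball x0 R))"
    by (intro compact_continuous_image compact_Times) (auto intro: continuous_on_subset)
  then have "bdd_above (?f ` ({0..T} \<times> cball x0 R))"
    by (intro bounded_imp_bdd_above compact_imp_bounded)
  then obtain B where B: "\<And>q. q \<in> {0..T} \<times> cball x0 R \<Longrightarrow> ?f q \<le> B"
    unfolding bdd_above_def by (meson imageI)
  show ?thesis
  proof (rule bdd_aboveI2)
    fix q assume q: "q \<in> {0..T} \<times> (UNIV::'a set)"
    show "?f q \<le> max B 1"
    proof (cases "R \<le> norm (snd q - x0)")
      case True
      then have "?f q \<le> 1" using R[of "snd q" "fst q"] q by auto
      then show ?thesis by simp
    next
      case False
      then have "?f q \<le> B"
        using q by (intro B) (auto simp: dist_norm norm_minus_commute)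
      then show ?thesis by simp
    qed
  qed
qed

lemma le_C_theta_norm:
  assumes "in_C_theta T \<theta> x0 z" "0 < \<theta>" "t \<in> {0..T}"
  shows "\<bar>z t x\<bar> \<le> C_theta_norm T \<theta> x0 z * weight \<theta> x0 x"
proof -
  have "\<bar>z t x\<bar> / weight \<theta> x0 x \<le> C_theta_norm T \<theta> x0 z"
    using cSUP_upper[OF _ in_C_theta_bdd_above[OF assms(1,2)], of "(t, x)"] assms(3)
    by (simp add: C_theta_norm_def weight_def)
  then show ?thesis
    by (subst (asm) pos_divide_le_eq) auto
qed

text \<open>Beyond the threshold R with R^(p - 2) = c one has r^p = r^(p - 2) r^2 <= c r^2, as p <
  2; below it r^p <= R^p.\<close>

lemma powr_le_quadratic:
  fixes p c :: real
  assumes "0 \<le> p" "p < 2" "0 < c"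
  obtains C where "0 \<le> C" "\<And>r. 0 \<le> r \<Longrightarrow> r powr p \<le> C + c * r\<^sup>2"
proof (rule that)
  define R where "R = c powr (1 / (p - 2))"
  have R: "0 < R" "R powr (p - 2) = c"
    using assms by (simp_all add: R_def powr_powr)
  show "0 \<le> R powr p" by simp
  fix r :: real assume r: "0 \<le> r"
  show "r powr p \<le> R powr p + c * r\<^sup>2"
  proof (cases "r \<le> R")
    case True
    then have "r powr p \<le> R powr p" using r assms by (intro powr_mono2) auto
    then show ?thesis using assms by (simp add: add_increasing2)
  next
    case False
    have "r powr p = r powr (p - 2) * r\<^sup>2"
      using False R by (simp flip: powr_add powr_numeral)
    also have "r powr (p - 2) \<le> R powr (p - 2)"
      using False R assms by (intro powr_mono2') auto
    finally show ?thesis using R by (simp add: mult_right_mono add_increasing)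
  qed
qed

text \<open>\<theta> \<nu> < 2 makes |u|^\<nu> subquadratic in r, like r^\<beta>; each of the two
  gets half of the budget c r^2. The case \<beta> = 0 is separated because
  \<open>0 powr 0 = 0\<close>, whereas |x - x0|^0 means 1.\<close>

lemma nonlinearity_growth:
  fixes K \<nu> \<beta> \<theta> N c :: real
  assumes "0 < K" "0 < \<nu>" "0 \<le> \<beta>" "\<beta> < 2" "0 < \<theta>" "\<theta> < 2 / \<nu>" "0 \<le> N" "0 < c"
  obtains C where "\<And>r u. 0 \<le> r \<Longrightarrow> \<bar>u\<bar> \<le> N * (1 + r powr \<theta>) \<Longrightarrow>
    K * exp (K * ((if \<beta> = 0 then 1 else r powr \<beta>) + \<bar>u\<bar> powr \<nu>)) \<le> C * exp (c * r\<^sup>2)"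
proof -
  define Q where "Q = 2 powr \<nu> * N powr \<nu>"
  have Q: "0 \<le> Q" by (simp add: Q_def)
  have "\<theta> * \<nu> < 2" using assms by (simp add: field_simps)
  obtain C1 where C1: "0 \<le> C1" "\<And>r. 0 \<le> r \<Longrightarrow> r powr \<beta> \<le> C1 + c / (2 * K) * r\<^sup>2"
    using powr_le_quadratic[of \<beta> "c / (2 * K)"] assms by auto
  \<comment> \<open>After multiplication by Q the quadratic rate is at most c / (2 K); Q + 1
    replaces Q because Q vanishes when N = 0.\<close>
  obtain C2 where C2: "0 \<le> C2" "\<And>r. 0 \<le> r \<Longrightarrow> r powr (\<theta> * \<nu>) \<le> C2 + c / (2 * K * (Q + 1)) * r\<^sup>2"
    using powr_le_quadratic[of "\<theta> * \<nu>" "c / (2 * K * (Q + 1))"] assms Q \<open>\<theta> * \<nu> < 2\<close> by auto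
  show thesis
  proof (rule that[of "K * exp (K * (1 + C1 + Q * (1 + C2)))"])
    fix r u :: real
    assume r: "0 \<le> r" and u: "\<bar>u\<bar> \<le> N * (1 + r powr \<theta>)"
    have "(if \<beta> = 0 then 1 else r powr \<beta>) \<le> 1 + r powr \<beta>" by simp
    also have "\<dots> \<le> 1 + C1 + c / (2 * K) * r\<^sup>2" using C1(2)[OF r] by simp
    finally have 1: "(if \<beta> = 0 then 1 else r powr \<beta>) \<le> 1 + C1 + c / (2 * K) * r\<^sup>2" .
    have "\<bar>u\<bar> powr \<nu> \<le> (N * (1 + r powr \<theta>)) powr \<nu>"
      using u assms by (intro powr_mono2) auto
    also have "\<dots> = N powr \<nu> * (1 + r powr \<theta>) powr \<nu>"
      by (rule powr_mult)
    also have "\<dots> \<le> N powr \<nu> * (2 powr \<nu> * (1 powr \<nu> + (r powr \<theta>) powr \<nu>))"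
      using assms by (intro mult_left_mono add_powr_le) auto
    also have "\<dots> = Q * (1 + r powr (\<theta> * \<nu>))"
      by (simp add: Q_def powr_powr)
    also have "\<dots> \<le> Q * (1 + (C2 + c / (2 * K * (Q + 1)) * r\<^sup>2))"
      using C2(2)[OF r] Q by (intro mult_left_mono) auto
    also have "\<dots> = Q * (1 + C2) + Q / (Q + 1) * (c / (2 * K) * r\<^sup>2)"
      by (simp add: algebra_simps)
    also have "Q / (Q + 1) * (c / (2 * K) * r\<^sup>2) \<le> 1 * (c / (2 * K) * r\<^sup>2)"
      using Q assms by (intro mult_right_mono) auto
    finally have 2: "\<bar>u\<bar> powr \<nu> \<le> Q * (1 + C2) + c / (2 * K) * r\<^sup>2" by simp
    have "K * ((if \<beta> = 0 then 1 else r powr \<beta>) + \<bar>u\<bar> powr \<nu>)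
        \<le> K * (1 + C1 + Q * (1 + C2) + 2 * (c / (2 * K) * r\<^sup>2))"
      using 1 2 assms by (intro mult_left_mono) auto
    also have "\<dots> = K * (1 + C1 + Q * (1 + C2)) + c * r\<^sup>2"
      using assms by (simp add: field_simps)
    finally have "exp (K * ((if \<beta> = 0 then 1 else r powr \<beta>) + \<bar>u\<bar> powr \<nu>))
        \<le> exp (K * (1 + C1 + Q * (1 + C2))) * exp (c * r\<^sup>2)"
      by (simp flip: exp_add)
    then show "K * exp (K * ((if \<beta> = 0 then 1 else r powr \<beta>) + \<bar>u\<bar> powr \<nu>))
        \<le> K * exp (K * (1 + C1 + Q * (1 + C2))) * exp (c * r\<^sup>2)"
      using assms by (simp add: mult.assoc)
  qed
qed

text \<open>With v the difference of the two Duhamel terms and H the difference of the sources,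
  \<open>mild_comparison\<close> applies. The bound is one-sided; exchanging the solutions yields
  the one for -v.\<close>

lemma mild_difference_le:
  fixes \<phi> :: "real \<Rightarrow> 'a::euclidean_space \<Rightarrow> real \<Rightarrow> real" and x0 :: 'a
  assumes T: "0 < T" and \<theta>: "0 < \<theta>"
    and diss: "\<And>t x u1 u2. t \<in> {0..T} \<Longrightarrow> u2 < u1 \<Longrightarrow> \<phi> t x u1 - \<phi> t x u2 \<le> \<kappa> * (u1 - u2)"
    and K: "0 < K" and \<nu>: "0 < \<nu>" "\<theta> < 2 / \<nu>" and \<beta>: "0 \<le> \<beta>" "\<beta> < 2"
    and growth: "\<And>t x u. t \<in> {0..T} \<Longrightarrow> \<bar>\<phi> t x u\<bar> \<le>
        K * exp (K * ((if \<beta> = 0 then 1 else norm (x - x0) powr \<beta>) + \<bar>u\<bar> powr \<nu>))"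
    and zC: "in_C_theta T \<theta> x0 z1" "in_C_theta T \<theta> x0 z2"
    and LC: "in_C_theta T \<theta> x0 L1" "in_C_theta T \<theta> x0 L2"
    and mild: "mild_solution T \<phi> z1 L1" "mild_solution T \<phi> z2 L2"
    and A: "0 < A" "2 * C_theta_norm T \<theta> x0 (\<lambda>t x. z1 t x - z2 t x) \<le> A"
    and t: "t \<in> {0..T}"
  shows "(L1 t x - L2 t x) - (z1 t x - z2 t x) \<le> exp ((2 * max \<kappa> 0 + 1) * t) * (A * heat_weight \<theta> x0 t x)"
proof -
  define f where "f = (\<lambda>L t x p. indicator ({0..t} \<times> UNIV) p *\<^sub>R
      (heat_kernel (t - fst p) (x - snd p) * \<phi> (fst p) (snd p) (L (fst p) (snd p))))"
  \<comment> \<open>Setting H = 0 at s = T does not change the integrals, since for t <= T the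
    kernel \<open>heat_kernel0 (t - s)\<close> vanishes there; it allows H to be recovered by
    division below.\<close>
  define H where "H = (\<lambda>p. if 0 \<le> fst p \<and> fst p < T
      then \<phi> (fst p) (snd p) (L1 (fst p) (snd p)) - \<phi> (fst p) (snd p) (L2 (fst p) (snd p)) else 0)"
  have f_int: "integrable lborel (f L1 t x)" "integrable lborel (f L2 t x)" if "t \<in> {0..T}" for t x
    using mild that unfolding mild_solution_def set_integrable_def f_def by auto
  have L_eq: "L1 t x = (\<integral>p. f L1 t x p \<partial>lborel) + z1 t x" "L2 t x = (\<integral>p. f L2 t x p \<partial>lborel) + z2 t x"
    if "t \<in> {0..T}" for t x
    using mild that unfolding mild_solution_def set_lebesgue_integral_def f_def by auto
  have kH: "heat_kernel0 (t - fst p) (x - snd p) * H p = f L1 t x p - f L2 t x p" if "t \<in> {0..T}" for t x p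
    using that by (cases p) (auto simp: heat_kernel0_def H_def f_def indicator_def algebra_simps)
  \<comment> \<open>Measurability is extracted from the mild formulation: at (T, 0) the kernel times
    the source is integrable, and on [0, T) the kernel is positive, so it can be divided
    out.\<close>
  have Hm: "H \<in> borel_measurable borel"
  proof -
    have [measurable]: "f L1 T 0 \<in> borel_measurable borel" "f L2 T 0 \<in> borel_measurable borel"
      using f_int[of T 0] T by (auto dest: borel_measurable_integrable)
    have "H = (\<lambda>p. if 0 \<le> fst p \<and> fst p < T then (f L1 T 0 p - f L2 T 0 p) / heat_kernel (T - fst p) (- snd p) else 0)"
    proof
      fix p :: "real \<times> 'a"
      show "H p = (if 0 \<le> fst p \<and> fst p < T then (f L1 T 0 p - f L2 T 0 p) / heat_kernel (T - fst p) (- snd p) else 0)"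
      proof (cases "0 \<le> fst p \<and> fst p < T")
        case True
        then have "0 < heat_kernel (T - fst p) (- snd p)" by (intro heat_kernel_pos) auto
        then show ?thesis
          using kH[of T p 0] T True by (simp add: heat_kernel0_def field_simps)
      next
        case False
        then show ?thesis by (auto simp: H_def)
      qed
    qed
    also have "\<dots> \<in> borel_measurable borel" by measurable
    finally show ?thesis .
  qed
  define N where "N = max (C_theta_norm T \<theta> x0 L1) (C_theta_norm T \<theta> x0 L2)"
  have N_le: "\<bar>L1 s y\<bar> \<le> N * (1 + norm (y - x0) powr \<theta>)" "\<bar>L2 s y\<bar> \<le> N * (1 + norm (y - x0) powr \<theta>)"
    if "s \<in> {0..T}" for s y
  proof -
    show "\<bar>L1 s y\<bar> \<le> N * (1 + norm (y - x0) powr \<theta>)"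
      by (rule order_trans[OF le_C_theta_norm[OF LC(1) \<theta> that, unfolded weight_def] mult_right_mono]) (auto simp: N_def)
    show "\<bar>L2 s y\<bar> \<le> N * (1 + norm (y - x0) powr \<theta>)"
      by (rule order_trans[OF le_C_theta_norm[OF LC(2) \<theta> that, unfolded weight_def] mult_right_mono]) (auto simp: N_def)
  qed
  have N: "0 \<le> N"
  proof -
    have "0 \<le> N * (1 + norm (x0 - x0) powr \<theta>)" using N_le(1)[of 0 x0] T by force
    then show ?thesis by simp
  qed
  have H_growth: "\<exists>C. \<forall>p. \<bar>H p\<bar> \<le> C * exp (c * (norm (snd p - x0))\<^sup>2)" if c: "0 < c" for c
  proof -
    obtain C where C: "\<And>r u. 0 \<le> r \<Longrightarrow> \<bar>u\<bar> \<le> N * (1 + r powr \<theta>) \<Longrightarrow>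
      K * exp (K * ((if \<beta> = 0 then 1 else r powr \<beta>) + \<bar>u\<bar> powr \<nu>)) \<le> C * exp (c * r\<^sup>2)"
      using nonlinearity_growth[OF K \<nu>(1) \<beta> \<theta> \<nu>(2) N c] by metis
    have b: "\<bar>\<phi> s y u\<bar> \<le> C * exp (c * (norm (y - x0))\<^sup>2)"
      if "s \<in> {0..T}" "\<bar>u\<bar> \<le> N * (1 + norm (y - x0) powr \<theta>)" for s y u
      using order_trans[OF growth[OF that(1), of y u] C[OF norm_ge_zero that(2)]] .
    have C0: "0 \<le> C"
    proof -
      have "0 \<le> C * exp (c * 0\<^sup>2)"
        using C[of 0 0] N K by (intro order_trans[OF _ C[of 0 0]]) auto
      then show ?thesis by simp
    qed
    have "\<bar>H p\<bar> \<le> 2 * C * exp (c * (norm (snd p - x0))\<^sup>2)" for p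
    proof (cases "0 \<le> fst p \<and> fst p < T")
      case True
      then have "fst p \<in> {0..T}" by auto
      moreover have "\<bar>H p\<bar> \<le> \<bar>\<phi> (fst p) (snd p) (L1 (fst p) (snd p))\<bar> + \<bar>\<phi> (fst p) (snd p) (L2 (fst p) (snd p))\<bar>"
        using True by (simp add: H_def abs_triangle_ineq4)
      ultimately show ?thesis
        using b[OF _ N_le(1)[of "fst p" "snd p"]] b[OF _ N_le(2)[of "fst p" "snd p"]] by force
    next
      case False
      then show ?thesis using C0 by (auto simp: H_def)
    qed
    then show ?thesis by blast
  qed
  have "in_C_theta T \<theta> x0 (\<lambda>t x. z1 t x - z2 t x)" "in_C_theta T \<theta> x0 (\<lambda>t x. (L1 t x - L2 t x) - (z1 t x - z2 t x))"
    by (intro in_C_theta_diff zC LC)+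
  note in_C = this
  show ?thesis
  proof (rule mild_comparison[where H = H and T = T and M = "C_theta_norm T \<theta> x0 (\<lambda>t x. z1 t x - z2 t x)"
        and \<zeta> = "\<lambda>t x. z1 t x - z2 t x" and v = "\<lambda>t x. (L1 t x - L2 t x) - (z1 t x - z2 t x)" and k = "max \<kappa> 0"])
    show "continuous_on ({0..T} \<times> UNIV) (\<lambda>(t, x). z1 t x - z2 t x)"
      using in_C(1) by (simp add: in_C_theta_def)
    show "\<bar>z1 s y - z2 s y\<bar> \<le> C_theta_norm T \<theta> x0 (\<lambda>t x. z1 t x - z2 t x) * weight \<theta> x0 y" if "s \<in> {0..T}" for s y
      using le_C_theta_norm[OF in_C(1) \<theta> that] .
    show "integrable lborel (\<lambda>p. heat_kernel0 (s - fst p) (y - snd p) * H p)" if "s \<in> {0..T}" for s y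
      unfolding kH[OF that] using f_int[OF that] by simp
    show "(L1 s y - L2 s y) - (z1 s y - z2 s y) = (\<integral>p. heat_kernel0 (s - fst p) (y - snd p) * H p \<partial>lborel)"
      if "s \<in> {0..T}" for s y
      unfolding kH[OF that] using f_int[OF that, of y] L_eq[OF that, of y] by simp
    show "H (s, y) \<le> max \<kappa> 0 * (L1 s y - L2 s y - (z1 s y - z2 s y) + (z1 s y - z2 s y))"
      if "s \<in> {0..T}" "0 < L1 s y - L2 s y - (z1 s y - z2 s y) + (z1 s y - z2 s y)" for s y
    proof -
      have pos: "0 < L1 s y - L2 s y" using that by simp
      \<comment> \<open>The maximum with 0 covers s = T, where H is 0 while \<kappa> may be
        negative.\<close>
      have "H (s, y) \<le> max (\<kappa> * (L1 s y - L2 s y)) 0"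
        using diss[OF that(1), of "L2 s y" "L1 s y" y] pos by (auto simp: H_def)
      also have "\<dots> \<le> max \<kappa> 0 * (L1 s y - L2 s y)"
        using pos by (auto simp: max_def)
      finally show ?thesis by simp
    qed
    show "H (s, y) = 0" if "s < 0" for s y using that by (simp add: H_def)
  qed (use assms Hm H_growth in_C in auto)
qed

section \<open>From one-sided bounds to the norm estimate\<close>

theorem theorem2p12:
  fixes T \<theta> \<kappa> :: real
  assumes "T > 0" and "\<theta> > 0"
  shows "\<exists>K'>0. \<forall>(x0::'a::euclidean_space) (\<phi>::real \<Rightarrow> 'a \<Rightarrow> real \<Rightarrow> real) K \<nu> \<beta> z1 z2 L1 L2.
     (\<forall>t\<in>{0..T}. \<forall>x u1 u2. u2 < u1 \<longrightarrow> \<phi> t x u1 - \<phi> t x u2 \<le> \<kappa> * (u1 - u2)) \<and>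
     K > 0 \<and> \<nu> > 0 \<and> 0 \<le> \<beta> \<and> \<beta> < 2 \<and>
     (\<forall>t\<in>{0..T}. \<forall>x u. \<bar>\<phi> t x u\<bar> \<le>
        K * exp (K * ((if \<beta> = 0 then 1 else norm (x - x0) powr \<beta>) + \<bar>u\<bar> powr \<nu>))) \<and>
     \<theta> < 2 / \<nu> \<and>
     in_C_theta T \<theta> x0 z1 \<and> in_C_theta T \<theta> x0 z2 \<and>
     in_C_theta T \<theta> x0 L1 \<and> in_C_theta T \<theta> x0 L2 \<and>
     mild_solution T \<phi> z1 L1 \<and> mild_solution T \<phi> z2 L2
     \<longrightarrow> C_theta_norm T \<theta> x0 (\<lambda>t x. L1 t x - L2 t x) \<le> K' * C_theta_norm T \<theta> x0 (\<lambda>t x. z1 t x - z2 t x)"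
proof -
  obtain C where C: "0 < C" "\<And>x0 x t. 0 \<le> t \<Longrightarrow> t \<le> T \<Longrightarrow>
      heat_weight \<theta> x0 t (x::'a) \<le> C * weight \<theta> x0 x"
    using heat_weight_le[of \<theta> T] assms by (metis less_imp_le)
  \<comment> \<open>C was obtained before x0 and \<phi> are fixed, so B depends only on T, \<theta>,
    \<kappa> and the dimension.\<close>
  define B where "B = exp ((2 * max \<kappa> 0 + 1) * T) * C"
  have B: "0 < B" using C by (simp add: B_def)
  show ?thesis
  \<comment> \<open>The term 2 B comes from the barrier with A close to 2 M, and 1 from adding z1 -
    z2 back to v.\<close>
  proof (intro exI[of _ "2 * B + 1"] conjI allI impI, goal_cases)
    case 1
    show ?case using B by simp
  next
    case (2 x0 \<phi> K \<nu> \<beta> z1 z2 L1 L2)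
    define M where "M = C_theta_norm T \<theta> x0 (\<lambda>t x. z1 t x - z2 t x)"
    have M': "C_theta_norm T \<theta> x0 (\<lambda>t x. z2 t x - z1 t x) = M"
      by (simp add: M_def C_theta_norm_def abs_minus_commute)
    have z: "\<bar>z1 t x - z2 t x\<bar> \<le> M * weight \<theta> x0 x" if "t \<in> {0..T}" for t x
      using 2 le_C_theta_norm[OF in_C_theta_diff \<open>\<theta> > 0\<close> that, of x0 z1 z2 x] by (simp add: M_def)
    have M: "0 \<le> M"
    proof -
      have "0 \<le> M * weight \<theta> x0 x0" using z[of 0 x0] assms by force
      then show ?thesis by (meson mult_neg_pos not_le weight_pos)
    qed
    have le: "C_theta_norm T \<theta> x0 (\<lambda>t x. L1 t x - L2 t x) \<le> (2 * B + 1) * M + \<epsilon>" if "0 < \<epsilon>" for \<epsilon>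
    proof -
      \<comment> \<open>The comparison requires A > 0 even if M = 0; the surplus \<epsilon> / B
        costs \<epsilon> in A B and is removed at the end by letting \<epsilon> tend to 0.\<close>
      define A where "A = 2 * M + \<epsilon> / B"
      have A: "0 < A" "2 * M \<le> A" using M B that by (auto simp: A_def add_nonneg_pos)
      have AB: "A * B = 2 * B * M + \<epsilon>" using B by (simp add: A_def algebra_simps)
      have w: "\<bar>L1 t x - L2 t x\<bar> \<le> ((2 * B + 1) * M + \<epsilon>) * weight \<theta> x0 x" if t: "t \<in> {0..T}" for t x
      proof -
        have "exp ((2 * max \<kappa> 0 + 1) * t) * (A * heat_weight \<theta> x0 t x)
            \<le> exp ((2 * max \<kappa> 0 + 1) * T) * (A * (C * weight \<theta> x0 x))"
          using t A C(2)[of t x0 x] by (intro mult_mono mult_left_mono iffD2[OF exp_le_cancel_iff]) auto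
        also have "\<dots> = A * B * weight \<theta> x0 x" by (simp add: B_def)
        finally have e: "exp ((2 * max \<kappa> 0 + 1) * t) * (A * heat_weight \<theta> x0 t x) \<le> A * B * weight \<theta> x0 x" .
        have "(L1 t x - L2 t x) - (z1 t x - z2 t x) \<le> exp ((2 * max \<kappa> 0 + 1) * t) * (A * heat_weight \<theta> x0 t x)"
          using 2 A t assms unfolding M_def by (intro mild_difference_le[where K = K and \<nu> = \<nu> and \<beta> = \<beta> and \<phi> = \<phi> and T = T]) auto
        moreover have "(L2 t x - L1 t x) - (z2 t x - z1 t x) \<le> exp ((2 * max \<kappa> 0 + 1) * t) * (A * heat_weight \<theta> x0 t x)"
          using 2 A t assms by (intro mild_difference_le[where K = K and \<nu> = \<nu> and \<beta> = \<beta> and \<phi> = \<phi> and T = T]) (auto simp: M')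
        ultimately have "\<bar>L1 t x - L2 t x\<bar> \<le> A * B * weight \<theta> x0 x + M * weight \<theta> x0 x"
          using z[OF t, of x] e by linarith
        then show ?thesis by (simp add: AB algebra_simps)
      qed
      show ?thesis
        unfolding C_theta_norm_def
      proof (rule cSUP_least)
        show "{0..T} \<times> (UNIV::'a set) \<noteq> {}" using assms by auto
        fix p assume p: "p \<in> {0..T} \<times> (UNIV::'a set)"
        then have "\<bar>L1 (fst p) (snd p) - L2 (fst p) (snd p)\<bar> / weight \<theta> x0 (snd p) \<le> (2 * B + 1) * M + \<epsilon>"
          using w[of "fst p" "snd p"] by (subst pos_divide_le_eq) auto
        then show "\<bar>L1 (fst p) (snd p) - L2 (fst p) (snd p)\<bar> / (1 + norm (snd p - x0) powr \<theta>) \<le> (2 * B + 1) * M + \<epsilon>"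
          by (simp add: weight_def)
      qed
    qed
    show ?case
      unfolding M_def[symmetric] by (rule field_le_epsilon) (rule le)
  qed
qed

end
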